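(* Consider the distributed online problem and the distributed online primal--dual composite mirror descent algorithm described in the context. Suppose that: (1) $\mathbb{X}\subseteq\mathbb{R}^p$ is closed and convex, and for all $i\in[n]$, $t\in\mathbb{N}_+$ the functions $r_t$, $f_{i,t}$, $g_{i,t}$ are convex ($g_{i,t}$ componentwise). (2) There is a constant $F>0$ with $|l_{i,t}(x)-l_{i,t}(y)|\le F$ for all $i\in[n]$, $t\in\mathbb{N}_+$, $x,y\in\mathbb{X}$. (3) For all $i\in[n]$, $t\in\mathbb{N}_+$, $x\in\mathbb{X}$ the subgradients $\nabla r_t(x),\nabla f_{i,t}(x),\nabla g_{i,t}(x)$ exist, and there are constants $G_1,G_2>0$ with $\|\nabla l_{i,t}(x)\|\le G_1$ and $\|\nabla g_{i,t}(x)\|\le G_2$ for all such $i,t,x$. (4) For every $t\in\mathbb{N}_+$: (a) there is a constant $w\in(0,1)$ (independent of $t$) such that $[W_t]_{ij}\ge w$ whenever $[W_t]_{ij}>0$; (b) $W_t$ is doubly stochastic; (c) there is an integer $B>0$ (independent of $t$) such that the directed graph $(\mathcal{V},\cup_{l=0}^{B-1}\mathcal{E}_{t+l})$ is strongly connected. (5) For every $x\in\mathbb{X}$ the function $\mathcal{D}_\psi(x,\cdot):\mathbb{X}\to\mathbb{R}$ is convex. (6) There is a constant $K>0$ with $\mathcal{D}_\psi(x,y)\le K$ for all $x,y\in\mathbb{X}$. Let $\{x_{i,t}\}$, $i\in[n]$, be the sequences generated by the algorithm with $$\alpha_t=\frac{1}{t^{c}},\qquad \gamma_t=\frac{\gamma_0}{\alpha_t},\qquad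 \forall t\in\mathbb{N}_+,$$ where $c\in(0,1)$ and $\gamma_0\in(0,\sigma/(4G_2^2)]$ are constants. Then, for any $T\in\mathbb{N}_+$, $$\mathrm{Net\text{-}Reg}(T)=\mathcal{O}(T^{\max\{c,1-c\}}),\qquad \frac{1}{n}\sum_{i=1}^n\sum_{t=1}^T\|[g_{t}(x_{i,t})]_+\|=\mathcal{O}(T^{1-c/2}).$$
   Context: Notation. $[n]=\{1,\dots,n\}$; $\|\cdot\|$ is the Euclidean norm for vectors and the induced 2-norm for matrices; $[x]_+$ is the componentwise positive part (projection onto the nonnegative orthant); vector inequalities are componentwise; $\nabla f(x)$ denotes a (sub)gradient of $f$ at $x$. For $g_{i,t}:\mathbb{R}^p\to\mathbb{R}^{m_i}$, $\nabla g_{i,t}(x)\in\mathbb{R}^{m_i\times p}$ is the matrix whose rows are subgradients of the components, so $g_{i,t}(y)\ge g_{i,t}(x)+\nabla g_{i,t}(x)(y-x)$. Bounds on subgradients hold for all subgradients, and $\nabla l_{i,t}(x)=\nabla f_{i,t}(x)+\nabla r_t(x)$. Problem. There are $n$ agents and a known set $\mathbb{X}\subseteq\mathbb{R}^p$. For each $i\in[n]$ and round $t\in\mathbb{N}_+$ there are a local loss $l_{i,t}=f_{i,t}+r_t:\mathbb{R}^p\to\mathbb{R}$ ($r_t$ common to all agents) and a local constraint function $g_{i,t}:\mathbb{R}^p\to\mathbb{R}^{m_i}$; these may vary arbitrarily with $t$. Set $l_t(x)=\frac1n\sum_{i=1}^n l_{i,t}(x)$, $g_t(x)=\mathrm{col}(g_{1,t}(x),\dots,g_{n,t}(x))\in\mathbb{R}^m$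 (stacked column vector), $m=\sum_i m_i$, and $$\mathcal{X}_T=\{x\in\mathbb{X}: g_t(x)\le \mathbf{0}_m,\ \forall t\in[T]\},$$ which is assumed nonempty for every $T$. Network regret is $$\mathrm{Net\text{-}Reg}(T)=\frac1n\sum_{i=1}^n\Big(\sum_{t=1}^T l_t(x_{i,t})-\min_{x\in\mathcal{X}_T}\sum_{t=1}^T l_t(x)\Big),$$ and network cumulative constraint violation is $\frac1n\sum_{i=1}^n\sum_{t=1}^T\|[g_t(x_{i,t})]_+\|$. Communication. At round $t$ the directed graph is $\mathcal{G}_t=(\mathcal{V},\mathcal{E}_t)$, $\mathcal{V}=[n]$, with mixing matrix $W_t\in\mathbb{R}^{n\times n}$ satisfying $[W_t]_{ij}>0$ if $(j,i)\in\mathcal{E}_t$ or $i=j$, and $[W_t]_{ij}=0$ otherwise. Bregman divergence. $\psi:\mathbb{R}^p\to\mathbb{R}$ is differentiable and strongly convex on $\mathbb{X}$ with parameter $\sigma>0$, i.e. $\psi(x)\ge\psi(y)+\langle\nabla\psi(y),x-y\rangle+\frac{\sigma}{2}\|x-y\|^2$ for $x,y\in\mathbb{X}$; $\mathcal{D}_\psi(x,y)=\psi(x)-\psi(y)-\langle\nabla\psi(y),x-y\rangle$. Algorithm. Input: a nonincreasing sequence $\{\alpha_t>0\}$ and a nondecreasing sequence $\{\gamma_t>0\}$. Initialize any $z_{i,1}\in\mathbb{X}$, $i\in[n]$. For $t=1,2,\dots$ and each $i\in[n]$: $$x_{i,t}=\sum_{j=1}^n[W_t]_{ij}z_{j,t},\qquad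 q_{i,t+1}=\gamma_t[g_{i,t}(x_{i,t})]_+,\qquad \omega_{i,t+1}=\nabla f_{i,t}(x_{i,t})+(\nabla g_{i,t}(x_{i,t}))^\top q_{i,t+1},$$ $$z_{i,t+1}=\arg\min_{x\in\mathbb{X}}\{\alpha_t\langle x,\omega_{i,t+1}\rangle+\alpha_t r_t(x)+\mathcal{D}_\psi(x,x_{i,t})\}.$$ Order notation. A quantity indexed by $T$ is $\mathcal{O}(b_T)$ if it is at most $C\,b_T$ for all $T\in\mathbb{N}_+$, with a constant $C>0$ independent of $T$ (depending only on the problem constants, the algorithm constants and the initial points). *)

theory Defs
  imports "HOL-Analysis.Analysis"
begin

(* Conventions.  The finite type 'n is the set of agents and real^'p is the decision space.
   Rounds are the natural numbers t >= 1; the values of sequences at round 0 are never used.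
   As m i depends on the agent, a vector in R^(m i) is a function nat => real and a matrix with
   m i rows is a function nat => real^'p (row k is the value at k), only the indices k < m i being
   relevant.  The k-th component of the constraint function of agent i in round t at the point x
   is g i t x k. *)

definition subgradient :: "('a::real_inner \<Rightarrow> real) \<Rightarrow> 'a \<Rightarrow> 'a \<Rightarrow> bool" where
  "subgradient h x s \<longleftrightarrow> (\<forall>y. h y \<ge> h x + s \<bullet> (y - x))"

definition subgradient_matrix ::
  "nat \<Rightarrow> ('a::real_inner \<Rightarrow> nat \<Rightarrow> real) \<Rightarrow> 'a \<Rightarrow> (nat \<Rightarrow> 'a) \<Rightarrow> bool" where
  "subgradient_matrix M h x A \<longleftrightarrow> (\<forall>k<M. subgradient (\<lambda>y. h y k) x (A k))"

(* The induced 2-norm of a matrix with rows A 0, ..., A (M - 1), written as in the library's onorm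
   (the quotient is 0 at v = 0); onorm itself needs a codomain type, which R^M does not have here. *)
definition matrix_norm2 :: "nat \<Rightarrow> (nat \<Rightarrow> 'a::real_inner) \<Rightarrow> real" where
  "matrix_norm2 M A = (SUP v. L2_set (\<lambda>k. A k \<bullet> v) {..<M} / norm v)"

definition gradient :: "('a::real_inner \<Rightarrow> real) \<Rightarrow> 'a \<Rightarrow> 'a" where
  "gradient \<psi> x = (THE d. GDERIV \<psi> x :> d)"

definition bregman :: "('a::real_inner \<Rightarrow> real) \<Rightarrow> 'a \<Rightarrow> 'a \<Rightarrow> real" where
  "bregman \<psi> x y = \<psi> x - \<psi> y - gradient \<psi> y \<bullet> (x - y)"

definition strongly_convex_on ::
  "'a::real_inner set \<Rightarrow> ('a \<Rightarrow> real) \<Rightarrow> real \<Rightarrow> bool" where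
  "strongly_convex_on X \<psi> \<sigma> \<longleftrightarrow>
     (\<forall>x\<in>X. \<forall>y\<in>X. \<psi> x \<ge> \<psi> y + gradient \<psi> y \<bullet> (x - y) + \<sigma> / 2 * (norm (x - y))\<^sup>2)"

definition mixing_matrix :: "('n::finite \<times> 'n) set \<Rightarrow> real^'n^'n \<Rightarrow> bool" where
  "mixing_matrix E W \<longleftrightarrow>
     (\<forall>i j. if (j, i) \<in> E \<or> i = j then W $ i $ j > 0 else W $ i $ j = 0)"

definition doubly_stochastic :: "real^'n^'n \<Rightarrow> bool" where
  "doubly_stochastic W \<longleftrightarrow>
     (\<forall>i j. W $ i $ j \<ge> 0) \<and> (\<forall>i. (\<Sum>j\<in>UNIV. W $ i $ j) = 1) \<and> (\<forall>j. (\<Sum>i\<in>UNIV. W $ i $ j) = 1)"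

(* Strong connectivity of the digraph with vertex set UNIV and edge set E. *)
definition strongly_connected_digraph :: "('n \<times> 'n) set \<Rightarrow> bool" where
  "strongly_connected_digraph E \<longleftrightarrow> (\<forall>u v. (u, v) \<in> E\<^sup>*)"

definition feasible ::
  "(real^'p) set \<Rightarrow> ('n \<Rightarrow> nat) \<Rightarrow> ('n \<Rightarrow> nat \<Rightarrow> real^'p \<Rightarrow> nat \<Rightarrow> real) \<Rightarrow> nat \<Rightarrow> (real^'p) set" where
  "feasible X m g T = {x \<in> X. \<forall>t\<in>{1..T}. \<forall>i. \<forall>k<m i. g i t x k \<le> 0}"

definition local_loss ::
  "('n \<Rightarrow> nat \<Rightarrow> real^'p \<Rightarrow> real) \<Rightarrow> (nat \<Rightarrow> real^'p \<Rightarrow> real) \<Rightarrow> 'n \<Rightarrow> nat \<Rightarrow> real^'p \<Rightarrow> real" where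
  "local_loss f r i t x = f i t x + r t x"

definition global_loss ::
  "('n::finite \<Rightarrow> nat \<Rightarrow> real^'p \<Rightarrow> real) \<Rightarrow> (nat \<Rightarrow> real^'p \<Rightarrow> real) \<Rightarrow> nat \<Rightarrow> real^'p \<Rightarrow> real" where
  "global_loss f r t x = (\<Sum>i\<in>UNIV. local_loss f r i t x) / real CARD('n)"

(* INF is the minimum in the setting considered: the losses are then continuous and the feasible
   set is compact and nonempty. *)
definition net_regret ::
  "(real^'p) set \<Rightarrow> ('n::finite \<Rightarrow> nat) \<Rightarrow> ('n \<Rightarrow> nat \<Rightarrow> real^'p \<Rightarrow> real) \<Rightarrow> (nat \<Rightarrow> real^'p \<Rightarrow> real)
     \<Rightarrow> ('n \<Rightarrow> nat \<Rightarrow> real^'p \<Rightarrow> nat \<Rightarrow> real) \<Rightarrow> ('n \<Rightarrow> nat \<Rightarrow> real^'p) \<Rightarrow> nat \<Rightarrow> real" where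
  "net_regret X m f r g x T =
     (\<Sum>i\<in>UNIV. (\<Sum>t=1..T. global_loss f r t (x i t))
               - (INF y\<in>feasible X m g T. \<Sum>t=1..T. global_loss f r t y)) / real CARD('n)"

(* The Euclidean norm of the positive part of the stacked vector of all agents' constraint
   functions in round t. *)
definition stacked_violation ::
  "('n::finite \<Rightarrow> nat) \<Rightarrow> ('n \<Rightarrow> nat \<Rightarrow> real^'p \<Rightarrow> nat \<Rightarrow> real) \<Rightarrow> nat \<Rightarrow> real^'p \<Rightarrow> real" where
  "stacked_violation m g t x = L2_set (\<lambda>(i, k). max 0 (g i t x k)) (SIGMA i:UNIV. {..<m i})"

definition net_ccv ::
  "('n::finite \<Rightarrow> nat) \<Rightarrow> ('n \<Rightarrow> nat \<Rightarrow> real^'p \<Rightarrow> nat \<Rightarrow> real) \<Rightarrow> ('n \<Rightarrow> nat \<Rightarrow> real^'p) \<Rightarrow> nat \<Rightarrow> real" where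
  "net_ccv m g x T = (\<Sum>i\<in>UNIV. \<Sum>t=1..T. stacked_violation m g t (x i t)) / real CARD('n)"

(* x is a sequence of iterates that the algorithm may generate from the initial points z1; df and
   dg are the subgradients that it selects along the way.  Nothing is required of that selection. *)
definition primal_dual_mirror_descent ::
  "(real^'p) set \<Rightarrow> (real^'p \<Rightarrow> real) \<Rightarrow> ('n::finite \<Rightarrow> nat)
     \<Rightarrow> ('n \<Rightarrow> nat \<Rightarrow> real^'p \<Rightarrow> real) \<Rightarrow> (nat \<Rightarrow> real^'p \<Rightarrow> real)
     \<Rightarrow> ('n \<Rightarrow> nat \<Rightarrow> real^'p \<Rightarrow> nat \<Rightarrow> real) \<Rightarrow> (nat \<Rightarrow> real^'n^'n)
     \<Rightarrow> (nat \<Rightarrow> real) \<Rightarrow> (nat \<Rightarrow> real) \<Rightarrow> ('n \<Rightarrow> real^'p) \<Rightarrow> ('n \<Rightarrow> nat \<Rightarrow> real^'p) \<Rightarrow> bool" where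
  "primal_dual_mirror_descent X \<psi> m f r g W \<alpha> \<gamma> z1 x \<longleftrightarrow>
     (\<exists>(z :: 'n \<Rightarrow> nat \<Rightarrow> real^'p) (q :: 'n \<Rightarrow> nat \<Rightarrow> nat \<Rightarrow> real) (\<omega> :: 'n \<Rightarrow> nat \<Rightarrow> real^'p)
       (df :: 'n \<Rightarrow> nat \<Rightarrow> real^'p) (dg :: 'n \<Rightarrow> nat \<Rightarrow> nat \<Rightarrow> real^'p).
        (\<forall>i. z1 i \<in> X \<and> z i 1 = z1 i) \<and>
        (\<forall>t\<ge>1. \<forall>i.
           x i t = (\<Sum>j\<in>UNIV. W t $ i $ j *\<^sub>R z j t) \<and>
           subgradient (f i t) (x i t) (df i t) \<and>
           subgradient_matrix (m i) (g i t) (x i t) (dg i t) \<and>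
           (\<forall>k<m i. q i (t + 1) k = \<gamma> t * max 0 (g i t (x i t) k)) \<and>
           \<omega> i (t + 1) = df i t + (\<Sum>k<m i. q i (t + 1) k *\<^sub>R dg i t k) \<and>
           is_arg_min (\<lambda>y. \<alpha> t * (y \<bullet> \<omega> i (t + 1)) + \<alpha> t * r t y + bregman \<psi> y (x i t))
             (\<lambda>y. y \<in> X) (z i (t + 1))))"

end

theory Submission
  imports Defs
begin

text \<open>
  Write \<open>d\<close> for the distance from \<open>x\<^sub>i\<close> to the next \<open>z\<^sub>i\<close> and \<open>v\<close> for the norm of the positive part of
  agent \<open>i\<close>'s own constraints at \<open>x\<^sub>i\<close>. The three-point inequality of the mirror step and Young's inequality,
  which is where \<open>\<gamma>0 \<le> \<sigma> / (4 G2\<^sup>2)\<close> enters, bound \<open>\<alpha> (l(x\<^sub>i) - l(y)) + \<gamma>0/2 v\<^sup>2 + \<sigma>/4 d\<^sup>2\<close> by a decrease of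
  \<open>D(y, \<cdot>)\<close> plus \<open>O(\<alpha>\<^sup>2)\<close>; mixing does not increase the sum of these divergences over the agents.
  Dividing by \<open>\<alpha>\<close> and summing by parts bounds the losses at the agents' own points; summing without
  dividing bounds the sums of \<open>v\<^sup>2\<close> and \<open>d\<^sup>2\<close> by \<open>O(T\<^sup>1\<^sup>-\<^sup>c)\<close>.
  Disagreement between agents is controlled by \<open>d\<close>: over \<open>n B\<close> rounds the product of the mixing matrices
  has all entries at least \<open>w\<close> to the power \<open>n B\<close>, so the diameter of the agents' points contracts by a
  fixed factor, up to the sum of the \<open>d\<close>. The resulting terms linear in \<open>d\<close> are absorbed into
  \<open>\<sigma>/(4 \<alpha>) d\<^sup>2\<close> in the regret and estimated through the sum of \<open>d\<^sup>2\<close> in the violation.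
\<close>

section \<open>The mirror step\<close>

lemma gradient_eqI:
  assumes "GDERIV \<psi> x :> d"
  shows "gradient \<psi> x = d"
proof -
  have "d' = d" if "GDERIV \<psi> x :> d'" for d'
  proof -
    have "(\<lambda>h. h \<bullet> d') = (\<lambda>h. h \<bullet> d)"
      using that assms unfolding gderiv_def by (rule has_derivative_unique)
    then have "(d' - d) \<bullet> d' = (d' - d) \<bullet> d" by (rule fun_cong)
    then have "(d' - d) \<bullet> (d' - d) = 0" by (simp add: inner_diff_right)
    then show ?thesis by simp
  qed
  then show ?thesis
    unfolding gradient_def using assms by blast
qed

text \<open>First-order optimality of \<open>z\<close> along the segment towards \<open>y\<close>,
  which stays in \<open>X\<close>. The function \<open>h\<close> is never differentiated: convexity
  replaces it by its chord, so only \<open>\<psi>\<close> contributes a derivative. The resulting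
  variational inequality, rewritten with divergences, is the claim.\<close>

lemma mirror_step:
  fixes z :: "'a::real_inner"
  assumes X: "convex X" and h: "convex_on X h"
    and "GDERIV \<psi> z :> d"
    and min: "is_arg_min (\<lambda>y. h y + bregman \<psi> y x) (\<lambda>y. y \<in> X) z"
    and y: "y \<in> X"
  shows "h z - h y \<le> bregman \<psi> y x - bregman \<psi> y z - bregman \<psi> z x"
proof -
  have z: "z \<in> X" using min by (auto simp: is_arg_min_def)
  have d: "gradient \<psi> z = d" using assms(3) by (rule gradient_eqI)
  \<comment> \<open>An upper bound for the change of the objective on moving from \<open>z\<close>
    by the fraction \<open>s\<close> towards \<open>y\<close>: \<open>h\<close> is replaced by its
    chord, and the parts of the divergence that do not depend on the moving point cancel.\<close>
  define k where "k s = s * (h y - h z) + \<psi> (z + s *\<^sub>R (y - z)) - \<psi> z - s * (gradient \<psi> x \<bullet> (y - z))" for s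
  have k_nonneg: "k s \<ge> 0" if "0 < s" "s < 1" for s
  proof -
    let ?p = "z + s *\<^sub>R (y - z)"
    have p: "?p = (1 - s) *\<^sub>R z + s *\<^sub>R y" by (simp add: algebra_simps)
    have "?p \<in> X" unfolding p using X z y that by (intro convexD) auto
    then have "h z + bregman \<psi> z x \<le> h ?p + bregman \<psi> ?p x"
      using min by (auto simp: is_arg_min_linorder)
    moreover have "h ?p \<le> (1 - s) * h z + s * h y"
      unfolding p using h z y that by (intro convex_onD) auto
    ultimately show ?thesis
      by (simp add: k_def bregman_def inner_simps algebra_simps)
  qed
  have "((\<lambda>s::real. \<psi> (z + s *\<^sub>R (y - z))) has_derivative (\<lambda>s. (s *\<^sub>R (y - z)) \<bullet> d)) (at 0)"
    by (rule has_derivative_compose[where f = "\<lambda>s. z + s *\<^sub>R (y - z)" and g = \<psi>])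
      (use assms(3) in \<open>auto simp: gderiv_def intro!: derivative_eq_intros\<close>)
  then have "((\<lambda>s::real. \<psi> (z + s *\<^sub>R (y - z))) has_real_derivative (y - z) \<bullet> d) (at 0)"
    by (simp add: has_field_derivative_def mult_commute_abs)
  then have D: "(k has_real_derivative (h y - h z + (y - z) \<bullet> d - gradient \<psi> x \<bullet> (y - z))) (at 0)"
    unfolding k_def by (auto intro!: derivative_eq_intros)
  have "h y - h z + (y - z) \<bullet> d - gradient \<psi> x \<bullet> (y - z) \<ge> 0"
  proof (rule ccontr)
    assume "\<not> h y - h z + (y - z) \<bullet> d - gradient \<psi> x \<bullet> (y - z) \<ge> 0"
    then have neg: "h y - h z + (y - z) \<bullet> d - gradient \<psi> x \<bullet> (y - z) < 0" by simp
    \<comment> \<open>A negative slope would force \<open>k s < k 0 = 0\<close> for small positive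
      \<open>s\<close>, against \<open>k_nonneg\<close>.\<close>
    obtain e where e: "e > 0" "\<And>s. s > 0 \<Longrightarrow> s < e \<Longrightarrow> k s < k 0"
      using DERIV_neg_dec_right[OF D neg] by auto
    define s where "s = min e 1 / 2"
    have "0 < s" "s < e" "s < 1" using e(1) by (auto simp: s_def)
    then show False using e(2)[of s] k_nonneg[of s] by (simp add: k_def)
  qed
  then show ?thesis
    by (simp add: bregman_def d inner_simps inner_commute algebra_simps)
qed

text \<open>A real supremum dominates its members only if they are bounded above. Row-wise
  Cauchy-Schwarz bounds all the quotients by the Frobenius norm of \<open>A\<close>.\<close>

lemma matrix_norm2_bound:
  fixes v :: "'a::real_inner"
  shows "L2_set (\<lambda>k. A k \<bullet> v) {..<M} \<le> matrix_norm2 M A * norm v"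
proof (cases "v = 0")
  case False
  have bound: "L2_set (\<lambda>k. A k \<bullet> u) {..<M} / norm u \<le> L2_set (\<lambda>k. norm (A k)) {..<M}" for u
  proof (cases "u = 0")
    case False
    have "L2_set (\<lambda>k. A k \<bullet> u) {..<M} \<le> L2_set (\<lambda>k. norm u * norm (A k)) {..<M}"
      unfolding L2_set_def
      by (intro real_sqrt_le_mono sum_mono) (use Cauchy_Schwarz_ineq2[of _ u] in \<open>simp add: abs_le_square_iff[symmetric] mult.commute[of "norm u"]\<close>)
    then show ?thesis
      using False by (simp add: L2_set_right_distrib[symmetric] field_simps)
  qed (simp add: L2_set_nonneg)
  have "L2_set (\<lambda>k. A k \<bullet> v) {..<M} / norm v \<le> matrix_norm2 M A"
    unfolding matrix_norm2_def by (rule cSUP_upper) (auto intro!: bdd_aboveI2 bound)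
  then show ?thesis using False by (simp add: field_simps)
qed (simp add: L2_set_def)

section \<open>Sums over rounds\<close>

text \<open>By the mean value theorem the increment of \<open>t powr (1 - c)\<close> over a unit
  interval is \<open>1 - c\<close> times a value of \<open>t powr (- c)\<close> inside it, hence at
  least \<open>1 - c\<close> times the value at the right end. These increments telescope.\<close>

lemma sum_powr_bound:
  fixes c :: real
  assumes "0 < c" "c < 1" "T \<ge> 1"
  shows "(\<Sum>t=1..T. 1 / real t powr c) \<le> real T powr (1 - c) / (1 - c)"
  using \<open>T \<ge> 1\<close>
proof (induction T rule: dec_induct)
  case base
  then show ?case using assms by simp
next
  case (step T)
  have "\<exists>\<xi>>real T. \<xi> < real T + 1 \<and>
      (real T + 1) powr (1 - c) - real T powr (1 - c)
        = (real T + 1 - real T) * ((1 - c) * \<xi> powr (1 - c - 1))"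
    using step(1) by (intro MVT2) (auto intro!: derivative_eq_intros)
  then obtain \<xi> where \<xi>: "\<xi> > real T" "\<xi> < real T + 1"
    "(real T + 1) powr (1 - c) - real T powr (1 - c) = (1 - c) * \<xi> powr (- c)" by auto
  have "(real T + 1) powr (- c) \<le> \<xi> powr (- c)"
    using \<xi> step(1) assms by (intro powr_mono2') auto
  then have "(1 - c) * (1 / (real T + 1) powr c) \<le> (real T + 1) powr (1 - c) - real T powr (1 - c)"
    unfolding \<xi>(3) using assms by (intro mult_left_mono) (auto simp: powr_minus_divide)
  then have "1 / (real T + 1) powr c \<le> ((real T + 1) powr (1 - c) - real T powr (1 - c)) / (1 - c)"
    using assms by (simp add: pos_le_divide_eq mult.commute)
  then show ?case
    using step by (simp add: diff_divide_distrib add.commute)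
qed

text \<open>Summation by parts for a bounded potential and a nondecreasing weight. The weight is
  \<open>t powr c\<close> in the regret and constantly 1 in the sums of squares.\<close>

lemma abel_sum_bound:
  fixes \<Phi> b :: "nat \<Rightarrow> real"
  assumes "\<And>t. t \<ge> 1 \<Longrightarrow> 0 \<le> \<Phi> t" "\<And>t. t \<ge> 1 \<Longrightarrow> \<Phi> t \<le> M"
    and "\<And>t. t \<ge> 1 \<Longrightarrow> 0 \<le> b t" "\<And>t. t \<ge> 1 \<Longrightarrow> b t \<le> b (Suc t)" and "T \<ge> 1"
  shows "(\<Sum>t=1..T. (\<Phi> t - \<Phi> (Suc t)) * b t) \<le> M * b T"
proof -
  \<comment> \<open>Keeping \<open>\<Phi> (Suc T)\<close> in the bound makes the induction close:
    passing from \<open>b T\<close> to \<open>b (Suc T)\<close> only enlarges it, because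
    \<open>M - \<Phi> (Suc T)\<close> is nonnegative.\<close>
  have "(\<Sum>t=1..T. (\<Phi> t - \<Phi> (Suc t)) * b t) \<le> (M - \<Phi> (Suc T)) * b T"
    using \<open>T \<ge> 1\<close>
  proof (induction T rule: dec_induct)
    case base
    then show ?case using assms by (auto intro!: mult_right_mono)
  next
    case (step T)
    have "(M - \<Phi> (Suc T)) * b T \<le> (M - \<Phi> (Suc T)) * b (Suc T)"
      using assms step(1) by (intro mult_left_mono) auto
    then show ?case using step by (simp add: algebra_simps)
  qed
  also have "\<dots> \<le> M * b T" using assms by (intro mult_right_mono) auto
  finally show ?thesis .
qed

text \<open>AM-GM: each term \<open>a\<close> is at most \<open>(s a\<^sup>2 + 1 / s) / 2\<close> with \<open>s = T\<close> to the power \<open>c / 2\<close>.\<close>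

lemma sum_le_of_sum_squares:
  fixes a :: "'n::finite \<Rightarrow> nat \<Rightarrow> real"
  assumes "(\<Sum>t=1..T. \<Sum>i\<in>UNIV. (a i t)\<^sup>2) \<le> M * real T powr (1 - c)" and T: "T \<ge> 1"
  shows "(\<Sum>t=1..T. \<Sum>i\<in>UNIV. a i t) \<le> (M + CARD('n)) / 2 * real T powr (1 - c / 2)"
proof -
  define s where "s = real T powr (c / 2)"
  have s: "s > 0" using T by (simp add: s_def)
  have s1: "s * real T powr (1 - c) = real T powr (1 - c / 2)"
    by (simp add: s_def powr_add[symmetric] field_simps)
  have s2: "real T / s = real T powr (1 - c / 2)"
    using T by (simp add: s_def powr_diff)
  have "a i t \<le> (s * (a i t)\<^sup>2 + 1 / s) / 2" for i t
  proof -
    have "0 \<le> (s * a i t - 1)\<^sup>2 / s" using s by simp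
    also have "\<dots> = s * (a i t)\<^sup>2 + 1 / s - 2 * a i t"
      using s by (simp add: power2_eq_square field_simps)
    finally show ?thesis by simp
  qed
  then have "(\<Sum>t=1..T. \<Sum>i\<in>UNIV. a i t) \<le> (\<Sum>t=1..T. \<Sum>i\<in>UNIV. (s * (a i t)\<^sup>2 + 1 / s) / 2)"
    by (intro sum_mono)
  also have "\<dots> = (s * (\<Sum>t=1..T. \<Sum>i\<in>UNIV. (a i t)\<^sup>2) + CARD('n) * (real T / s)) / 2"
    by (simp add: sum_divide_distrib[symmetric] sum.distrib sum_distrib_left[symmetric] mult.commute)
  also have "\<dots> \<le> (s * (M * real T powr (1 - c)) + CARD('n) * (real T / s)) / 2"
    using assms(1) s by simp
  also have "\<dots> = (M + CARD('n)) / 2 * real T powr (1 - c / 2)"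
    unfolding s2 s1[symmetric] by (simp add: algebra_simps)
  finally show ?thesis .
qed

section \<open>Consensus under time-varying mixing\<close>

lemma norm_diff_le_diameter:
  fixes u :: "'n::finite \<Rightarrow> 'a::real_normed_vector"
  shows "norm (u i - u j) \<le> diameter (range u)"
  using diameter_bounded_bound[of "range u" "u i" "u j"]
  by (simp add: dist_norm finite_imp_bounded)

lemma diameter_range_le:
  fixes u :: "'n::finite \<Rightarrow> 'a::real_normed_vector"
  assumes "\<And>i j. norm (u i - u j) \<le> d"
  shows "diameter (range u) \<le> d"
proof (rule diameter_le)
  show "range u \<noteq> {} \<or> 0 \<le> d" by blast
qed (use assms in auto)

text \<open>Both ends of a difference move by at most the total displacement. The total over the
  agents, cruder than a maximum, is used because it is the quantity that mixing does not
  increase.\<close>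

lemma diameter_range_perturb:
  fixes u v :: "'n::finite \<Rightarrow> 'a::real_normed_vector"
  shows "diameter (range u) \<le> diameter (range v) + 2 * (\<Sum>i\<in>UNIV. norm (u i - v i))"
proof (rule diameter_range_le)
  fix i j
  have "norm (u k - v k) \<le> (\<Sum>i\<in>UNIV. norm (u i - v i))" for k
    by (rule member_le_sum) auto
  from this[of i] this[of j] show "norm (u i - u j) \<le> diameter (range v) + 2 * (\<Sum>i\<in>UNIV. norm (u i - v i))"
    using norm_diff_le_diameter[of v i j]
      norm_triangle_ineq4[of "u i - v i" "u j - v j"] norm_triangle_ineq[of "v i - v j" "(u i - v i) - (u j - v j)"]
    by (simp add: algebra_simps)
qed

text \<open>Rows \<open>i\<close> and \<open>j\<close> are coupled independently: since each sums to
  one, the difference of the two averages is the average of \<open>u k - u l\<close> under the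
  product weights. The diagonal \<open>k = l\<close> contributes nothing and carries weight at least
  \<open>\<eta>\<^sup>2\<close>.\<close>

lemma diameter_contraction:
  fixes P :: "real^'n^'n" and u :: "'n::finite \<Rightarrow> 'a::real_normed_vector"
  assumes rows: "\<And>i. (\<Sum>j\<in>UNIV. P $ i $ j) = 1" and entries: "\<And>i j. P $ i $ j \<ge> \<eta>" and "\<eta> \<ge> 0"
  shows "diameter (range (\<lambda>i. \<Sum>j\<in>UNIV. P $ i $ j *\<^sub>R u j)) \<le> (1 - \<eta>\<^sup>2) * diameter (range u)"
proof (rule diameter_range_le)
  fix i j
  let ?d = "diameter (range u)"
  have nn: "P $ i $ k \<ge> 0" for i k using entries[of i k] \<open>\<eta> \<ge> 0\<close> by linarith
  have d: "?d \<ge> 0" using norm_diff_le_diameter[of u i i] by simp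
  have "(\<Sum>k\<in>UNIV. P $ i $ k *\<^sub>R u k) = (\<Sum>k\<in>UNIV. \<Sum>l\<in>UNIV. (P $ i $ k * P $ j $ l) *\<^sub>R u k)"
    by (simp add: scaleR_left.sum[symmetric] sum_distrib_left[symmetric] rows)
  moreover have "(\<Sum>l\<in>UNIV. P $ j $ l *\<^sub>R u l) = (\<Sum>l\<in>UNIV. \<Sum>k\<in>UNIV. (P $ i $ k * P $ j $ l) *\<^sub>R u l)"
    by (simp add: scaleR_left.sum[symmetric] sum_distrib_right[symmetric] rows)
  moreover have "\<dots> = (\<Sum>k\<in>UNIV. \<Sum>l\<in>UNIV. (P $ i $ k * P $ j $ l) *\<^sub>R u l)" by (rule sum.swap)
  ultimately have "norm ((\<Sum>k\<in>UNIV. P $ i $ k *\<^sub>R u k) - (\<Sum>k\<in>UNIV. P $ j $ k *\<^sub>R u k))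
      = norm (\<Sum>k\<in>UNIV. \<Sum>l\<in>UNIV. (P $ i $ k * P $ j $ l) *\<^sub>R (u k - u l))"
    by (simp add: sum_subtractf scaleR_diff_right)
  also have "\<dots> \<le> (\<Sum>k\<in>UNIV. \<Sum>l\<in>UNIV. P $ i $ k * P $ j $ l * norm (u k - u l))"
    by (rule order_trans[OF norm_sum sum_mono[OF order_trans[OF norm_sum sum_mono]]])
      (simp add: nn abs_mult)
  \<comment> \<open>The diagonal differences vanish, so the full diagonal share of \<open>?d\<close>
    can be subtracted.\<close>
  also have "\<dots> \<le> (\<Sum>k\<in>UNIV. \<Sum>l\<in>UNIV. P $ i $ k * P $ j $ l * ?d - (if l = k then P $ i $ k * P $ j $ k * ?d else 0))"
    using norm_diff_le_diameter[of u] nn by (intro sum_mono) (auto intro!: mult_left_mono)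
  also have "\<dots> = (\<Sum>k\<in>UNIV. \<Sum>l\<in>UNIV. P $ i $ k * P $ j $ l * ?d) - (\<Sum>k\<in>UNIV. P $ i $ k * P $ j $ k * ?d)"
    by (simp add: sum_subtractf)
  also have "(\<Sum>k\<in>UNIV. \<Sum>l\<in>UNIV. P $ i $ k * P $ j $ l * ?d) = ?d"
    by (simp add: sum_distrib_left[symmetric] sum_distrib_right[symmetric] rows)
  also have "?d - (\<Sum>k\<in>UNIV. P $ i $ k * P $ j $ k * ?d) \<le> ?d - \<eta>\<^sup>2 * ?d"
  proof -
    \<comment> \<open>The single diagonal term \<open>k = i\<close> is enough.\<close>
    have "\<eta>\<^sup>2 * ?d \<le> P $ i $ i * P $ j $ i * ?d"
      unfolding power2_eq_square using entries \<open>\<eta> \<ge> 0\<close> nn d by (intro mult_mono mult_nonneg_nonneg) auto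
    also have "\<dots> \<le> (\<Sum>k\<in>UNIV. P $ i $ k * P $ j $ k * ?d)"
      using nn d by (intro member_le_sum) auto
    finally show ?thesis by simp
  qed
  finally show "norm ((\<Sum>k\<in>UNIV. P $ i $ k *\<^sub>R u k) - (\<Sum>k\<in>UNIV. P $ j $ k *\<^sub>R u k)) \<le> (1 - \<eta>\<^sup>2) * ?d"
    by (simp add: algebra_simps)
qed

text \<open>The first factor is \<open>W (s + 1)\<close> and not \<open>W s\<close>: the product
  acts on the points \<open>x\<close> of round \<open>s\<close>, which \<open>W s\<close> has
  already mixed.\<close>

primrec transition :: "(nat \<Rightarrow> real^'n^'n) \<Rightarrow> nat \<Rightarrow> nat \<Rightarrow> real^'n^'n" where
  "transition W s 0 = mat 1"
| "transition W s (Suc k) = W (s + Suc k) ** transition W s k"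

locale mixing =
  fixes W :: "nat \<Rightarrow> real^'n::finite^'n" and E :: "nat \<Rightarrow> ('n \<times> 'n) set" and w :: real and B :: nat
  assumes mixing: "t \<ge> 1 \<Longrightarrow> mixing_matrix (E t) (W t)"
    and stochastic: "t \<ge> 1 \<Longrightarrow> doubly_stochastic (W t)"
    and weights: "t \<ge> 1 \<Longrightarrow> W t $ i $ j > 0 \<Longrightarrow> W t $ i $ j \<ge> w"
    and w_pos: "w > 0"
    and connected: "t \<ge> 1 \<Longrightarrow> strongly_connected_digraph (\<Union>l<B. E (t + l))"
begin

lemma W_nonneg: "t \<ge> 1 \<Longrightarrow> W t $ i $ j \<ge> 0"
  and W_row: "t \<ge> 1 \<Longrightarrow> (\<Sum>j\<in>UNIV. W t $ i $ j) = 1"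
  and W_col: "t \<ge> 1 \<Longrightarrow> (\<Sum>i\<in>UNIV. W t $ i $ j) = 1"
  using stochastic by (auto simp: doubly_stochastic_def)

lemma W_edge: "t \<ge> 1 \<Longrightarrow> (j, i) \<in> E t \<or> i = j \<Longrightarrow> W t $ i $ j \<ge> w"
  using mixing[of t] weights[of t i j] unfolding mixing_matrix_def by metis

lemma transition_nonneg: "transition W s k $ i $ j \<ge> 0"
  by (induction k arbitrary: i) (auto simp: mat_def matrix_matrix_mult_def W_nonneg intro!: sum_nonneg)

lemma transition_row: "(\<Sum>j\<in>UNIV. transition W s k $ i $ j) = 1"
proof (induction k arbitrary: i)
  case 0
  then show ?case by (simp add: mat_def)
next
  case (Suc k)
  have "(\<Sum>j\<in>UNIV. transition W s (Suc k) $ i $ j)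
      = (\<Sum>l\<in>UNIV. W (s + Suc k) $ i $ l * (\<Sum>j\<in>UNIV. transition W s k $ l $ j))"
    unfolding transition.simps matrix_matrix_mult_def sum_distrib_left by (simp, rule sum.swap)
  then show ?case by (simp only: Suc W_row) (simp add: W_row)
qed

text \<open>One summand of the matrix product, the route from \<open>j\<close> through
  \<open>l\<close> to \<open>i\<close>, already has the required weight; each round costs one factor
  \<open>w\<close>.\<close>

lemma transition_edge:
  assumes "transition W s k $ l $ j \<ge> w ^ k" "(l, i) \<in> E (s + Suc k) \<or> i = l"
  shows "transition W s (Suc k) $ i $ j \<ge> w ^ Suc k"
proof -
  have "w ^ Suc k \<le> W (s + Suc k) $ i $ l * transition W s k $ l $ j"
    using assms W_edge[of "s + Suc k" l i] w_pos transition_nonneg[of s k l j]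
    by (simp del: add_Suc_right) (intro mult_mono, auto)
  also have "\<dots> \<le> (\<Sum>l\<in>UNIV. W (s + Suc k) $ i $ l * transition W s k $ l $ j)"
    by (rule member_le_sum) (auto intro!: mult_nonneg_nonneg W_nonneg transition_nonneg)
  finally show ?thesis by (simp add: matrix_matrix_mult_def)
qed

text \<open>Self-loops: every agent keeps at least the share \<open>w\<close> of its own value, so
  an agent once reached stays reached.\<close>

lemma transition_mono:
  assumes "transition W s k $ i $ j \<ge> w ^ k" "k \<le> k'"
  shows "transition W s k' $ i $ j \<ge> w ^ k'"
  using assms(2)
  by (induction k' rule: dec_induct) (use assms(1) transition_edge in blast)+

text \<open>The set of agents reached with weight at least \<open>w ^ k\<close> gains a member in every window of
  \<open>B\<close> rounds until it is everything, because an edge of the window leaves it.\<close>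

lemma transition_spread:
  "card {i. transition W s (k * B) $ i $ j \<ge> w ^ (k * B)} \<ge> min CARD('n) (Suc k)"
proof (induction k)
  case 0
  have "j \<in> {i. transition W s (0 * B) $ i $ j \<ge> w ^ (0 * B)}" by (simp add: mat_def)
  then have "card {i. transition W s (0 * B) $ i $ j \<ge> w ^ (0 * B)} > 0" by (auto simp: card_gt_0_iff)
  then show ?case by linarith
next
  case (Suc k)
  define R where "R a = {i. transition W s a $ i $ j \<ge> w ^ a}" for a
  have mono: "R a \<subseteq> R b" if "a \<le> b" for a b
    using transition_mono that by (auto simp: R_def)
  have IH: "card (R (k * B)) \<ge> min CARD('n) (Suc k)" using Suc by (simp add: R_def)
  have "card (R (Suc k * B)) \<ge> min CARD('n) (Suc (Suc k))"
  proof (cases "R (k * B) = UNIV")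
    case True
    then have "R (Suc k * B) = UNIV" using mono[of "k * B" "Suc k * B"] by auto
    then show ?thesis by simp
  next
    case False
    then obtain v where v: "v \<notin> R (k * B)" by blast
    have "R (k * B) \<noteq> {}" using IH by (auto simp: min_def split: if_splits)
    then obtain u where u: "u \<in> R (k * B)" by blast
    have "(u, v) \<in> (\<Union>l<B. E (s + k * B + 1 + l))\<^sup>*"
      using connected[of "s + k * B + 1"] by (simp add: strongly_connected_digraph_def)
    then obtain a b where ab: "(a, b) \<in> (\<Union>l<B. E (s + k * B + 1 + l))" "a \<in> R (k * B)" "b \<notin> R (k * B)"
      using u v by (induction rule: rtrancl_induct) blast+
    then obtain l where l: "l < B" "(a, b) \<in> E (s + Suc (k * B + l))" by (auto simp: add.assoc)
    have "a \<in> R (k * B + l)" using ab(2) mono[of "k * B" "k * B + l"] by auto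
    then have "b \<in> R (Suc (k * B + l))" using transition_edge l(2) by (auto simp: R_def)
    then have "b \<in> R (Suc k * B)" using mono[of "Suc (k * B + l)" "Suc k * B"] l(1) by auto
    then have "R (k * B) \<subset> R (Suc k * B)" using mono[of "k * B" "Suc k * B"] ab(3) by auto
    then have "card (R (k * B)) < card (R (Suc k * B))" by (intro psubset_card_mono) auto
    then show ?thesis using IH by linarith
  qed
  then show ?case by (simp add: R_def)
qed

text \<open>Reachability gains at least one agent per \<open>B\<close> rounds until all are reached,
  so this many rounds suffice from any starting round.\<close>

definition window :: nat where "window = CARD('n) * B"

lemma transition_window: "transition W s window $ i $ j \<ge> w ^ window"
proof -
  have "card {i. transition W s window $ i $ j \<ge> w ^ window} \<ge> CARD('n)"
    using transition_spread[of "CARD('n)" s j] by (simp add: window_def)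
  then have "{i. transition W s window $ i $ j \<ge> w ^ window} = UNIV"
    by (intro card_seteq) auto
  then show ?thesis by blast
qed

text \<open>This is where the column sums being one matters: each norm on the right is distributed
  over the agents with total weight one.\<close>

lemma sum_norm_mix_le:
  fixes u :: "'n \<Rightarrow> 'a::real_normed_vector"
  assumes "t \<ge> 1"
  shows "(\<Sum>i\<in>UNIV. norm (\<Sum>j\<in>UNIV. W t $ i $ j *\<^sub>R u j)) \<le> (\<Sum>j\<in>UNIV. norm (u j))"
proof -
  have "(\<Sum>i\<in>UNIV. norm (\<Sum>j\<in>UNIV. W t $ i $ j *\<^sub>R u j))
      \<le> (\<Sum>i\<in>UNIV. \<Sum>j\<in>UNIV. W t $ i $ j * norm (u j))"
    using assms by (intro sum_mono order_trans[OF norm_sum]) (simp add: W_nonneg)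
  also have "\<dots> = (\<Sum>j\<in>UNIV. (\<Sum>i\<in>UNIV. W t $ i $ j) * norm (u j))"
    unfolding sum_distrib_right by (rule sum.swap)
  finally show ?thesis using assms by (simp add: W_col)
qed

section \<open>Disagreement when each mixing round is perturbed by a local move\<close>

context
  fixes x z :: "'n \<Rightarrow> nat \<Rightarrow> 'a::real_normed_vector" and R :: real
  assumes x_eq: "t \<ge> 1 \<Longrightarrow> x i t = (\<Sum>j\<in>UNIV. W t $ i $ j *\<^sub>R z j t)"
    and x_bounded: "t \<ge> 1 \<Longrightarrow> norm (x i t - x j t) \<le> R"
begin

text \<open>The true points and the unperturbed products applied to the points of round
  \<open>s\<close> go through the same mixing matrix in each round. Mixing does not increase the
  summed error, so each round adds only its own local moves.\<close>

lemma transition_error: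
  assumes "s \<ge> 1"
  shows "(\<Sum>i\<in>UNIV. norm (x i (s + k) - (\<Sum>j\<in>UNIV. transition W s k $ i $ j *\<^sub>R x j s)))
    \<le> (\<Sum>l<k. \<Sum>i\<in>UNIV. norm (z i (Suc (s + l)) - x i (s + l)))"
proof (induction k)
  case 0
  have "(\<Sum>j\<in>UNIV. transition W s 0 $ i $ j *\<^sub>R x j s) = x i s" for i
    by (simp add: mat_def if_distrib[where f = "\<lambda>c. c *\<^sub>R _"] cong: if_cong)
  then show ?case by simp
next
  case (Suc k)
  let ?y = "\<lambda>k i. \<Sum>j\<in>UNIV. transition W s k $ i $ j *\<^sub>R x j s"
  have y: "?y (Suc k) i = (\<Sum>l\<in>UNIV. W (s + Suc k) $ i $ l *\<^sub>R ?y k l)" for i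
    unfolding transition.simps matrix_matrix_mult_def scaleR_sum_right
    by (simp add: scaleR_left.sum) (rule sum.swap)
  have "(\<Sum>i\<in>UNIV. norm (x i (s + Suc k) - ?y (Suc k) i))
      = (\<Sum>i\<in>UNIV. norm (\<Sum>l\<in>UNIV. W (s + Suc k) $ i $ l *\<^sub>R (z l (s + Suc k) - ?y k l)))"
    unfolding y by (subst x_eq) (auto simp: sum_subtractf scaleR_diff_right)
  also have "\<dots> \<le> (\<Sum>l\<in>UNIV. norm (z l (s + Suc k) - ?y k l))"
    by (rule sum_norm_mix_le) simp
  also have "\<dots> \<le> (\<Sum>l\<in>UNIV. norm (z l (Suc (s + k)) - x l (s + k)) + norm (x l (s + k) - ?y k l))"
    by (intro sum_mono order_trans[OF _ norm_triangle_ineq]) simp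
  also have "\<dots> \<le> (\<Sum>l<Suc k. \<Sum>i\<in>UNIV. norm (z i (Suc (s + l)) - x i (s + l)))"
    using Suc by (simp add: sum.distrib)
  finally show ?case .
qed

lemma diameter_window:
  assumes "s \<ge> 1"
  shows "diameter (range (\<lambda>i. x i (s + window)))
    \<le> (1 - (w ^ window)\<^sup>2) * diameter (range (\<lambda>i. x i s))
      + 2 * (\<Sum>l<window. \<Sum>i\<in>UNIV. norm (z i (Suc (s + l)) - x i (s + l)))"
proof -
  have "diameter (range (\<lambda>i. \<Sum>j\<in>UNIV. transition W s window $ i $ j *\<^sub>R x j s))
      \<le> (1 - (w ^ window)\<^sup>2) * diameter (range (\<lambda>i. x i s))"
    using w_pos by (intro diameter_contraction transition_row transition_window) simp
  then show ?thesis
    using transition_error[OF assms, of window]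
      diameter_range_perturb[of "\<lambda>i. x i (s + window)" "\<lambda>i. \<Sum>j\<in>UNIV. transition W s window $ i $ j *\<^sub>R x j s"]
    by linarith
qed

text \<open>Summing the contraction over all starting rounds gives the sum of the diameters on both
  sides, with factor \<open>1 - \<eta>\<close> on the right. Moving it over leaves the first window,
  bounded through \<open>R\<close>, and the moves, each counted at most \<open>window\<close> times;
  dividing by \<open>\<eta>\<close> finishes.\<close>

lemma consensus_sum:
  "(\<Sum>t=1..T. norm (x i t - x j t))
    \<le> (window * R + 2 * window * (\<Sum>t=1..T. \<Sum>i\<in>UNIV. norm (z i (Suc t) - x i t))) / (w ^ window)\<^sup>2"
proof -
  define d where "d t = diameter (range (\<lambda>i. x i t))" for t
  define e where "e t = (\<Sum>i\<in>UNIV. norm (z i (Suc t) - x i t))" for t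
  define \<eta> where "\<eta> = (w ^ window)\<^sup>2"
  have \<eta>: "\<eta> > 0" using w_pos by (simp add: \<eta>_def)
  have e: "e t \<ge> 0" for t by (simp add: e_def sum_nonneg)
  have d: "norm (x i t - x j t) \<le> d t" for i j t
    using norm_diff_le_diameter[of "\<lambda>i. x i t"] by (simp add: d_def)
  have d0: "d t \<ge> 0" for t using order_trans[OF norm_ge_zero d] .
  have dR: "d t \<le> R" if "t \<ge> 1" for t
    unfolding d_def by (intro diameter_range_le x_bounded that)
  have R: "R \<ge> 0" using order_trans[OF d0[of 1] dR[of 1]] by simp
  have step: "d (t + window) - (1 - \<eta>) * d t \<le> 2 * (\<Sum>l<window. e (t + l))" if "t \<ge> 1" for t
    using diameter_window[OF that] by (simp add: d_def e_def \<eta>_def)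
  \<comment> \<open>A self-loop weight is at least \<open>w\<close> and its row sums to one. The
    resulting \<open>1 - \<eta> \<ge> 0\<close> later lets the contracted sum be extended to all
    rounds up to \<open>T\<close>.\<close>
  have "w \<le> 1"
    using W_edge[of 1 i i] W_row[of 1 i] member_le_sum[of i UNIV "\<lambda>j. W 1 $ i $ j"]
    by (simp add: W_nonneg)
  then have \<eta>1: "\<eta> \<le> 1" using w_pos by (simp add: \<eta>_def power_le_one)
  \<comment> \<open>If \<open>T \<le> window\<close>, the truncated difference
    \<open>T - window\<close> is 0, the shifted sum is empty, and all rounds lie in the first
    window.\<close>
  have split: "(\<Sum>t=1..T. d t) \<le> window * R + (\<Sum>t\<in>{1..T - window}. d (t + window))"
  proof -
    have "(\<Sum>t=1..T. d t) \<le> (\<Sum>t\<in>{1..window} \<union> (\<lambda>t. t + window) ` {1..T - window}. d t)"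
    proof (rule sum_mono2)
      show "{1..T} \<subseteq> {1..window} \<union> (\<lambda>t. t + window) ` {1..T - window}"
      proof
        fix t assume t: "t \<in> {1..T}"
        show "t \<in> {1..window} \<union> (\<lambda>t. t + window) ` {1..T - window}"
        proof (cases "t \<le> window")
          case False
          then have "t - window \<in> {1..T - window}" "t = (t - window) + window" using t by auto
          then show ?thesis by blast
        qed (use t in auto)
      qed
    qed (auto simp: d0)
    also have "\<dots> \<le> (\<Sum>t=1..window. d t) + (\<Sum>t\<in>(\<lambda>t. t + window) ` {1..T - window}. d t)"
      using d0 by (simp add: sum_Un sum_nonneg)
    also have "(\<Sum>t=1..window. d t) \<le> window * R"
      using sum_mono[of "{1..window}" d "\<lambda>_. R"] dR by simp
    also have "(\<Sum>t\<in>(\<lambda>t. t + window) ` {1..T - window}. d t) = (\<Sum>t\<in>{1..T - window}. d (t + window))"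
      by (subst sum.reindex) (simp_all only: o_def inj_on_add' refl)
    finally show ?thesis by simp
  qed
  have errors: "(\<Sum>t\<in>{1..T - window}. \<Sum>l<window. e (t + l)) \<le> window * (\<Sum>t=1..T. e t)"
  proof -
    have "(\<Sum>t\<in>{1..T - window}. e (t + l)) \<le> (\<Sum>t=1..T. e t)" if "l < window" for l
    proof -
      have "(\<Sum>t\<in>{1..T - window}. e (t + l)) = (\<Sum>t\<in>(\<lambda>t. t + l) ` {1..T - window}. e t)"
        by (subst sum.reindex) (simp_all only: o_def inj_on_add' refl)
      also have "\<dots> \<le> (\<Sum>t=1..T. e t)" using that by (intro sum_mono2) (auto simp: e)
      finally show ?thesis .
    qed
    then have "(\<Sum>l<window. \<Sum>t\<in>{1..T - window}. e (t + l)) \<le> (\<Sum>l<window. \<Sum>t=1..T. e t)"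
      by (intro sum_mono) auto
    then show ?thesis by (subst sum.swap) simp
  qed
  have "(\<Sum>t\<in>{1..T - window}. d (t + window)) - (\<Sum>t\<in>{1..T - window}. (1 - \<eta>) * d t)
      \<le> 2 * (\<Sum>t\<in>{1..T - window}. \<Sum>l<window. e (t + l))"
    unfolding sum_subtractf[symmetric] sum_distrib_left by (rule sum_mono) (use step in \<open>auto simp: sum_distrib_left\<close>)
  moreover have "(\<Sum>t\<in>{1..T - window}. (1 - \<eta>) * d t) \<le> (1 - \<eta>) * (\<Sum>t=1..T. d t)"
    unfolding sum_distrib_left using \<eta>1 d0 by (intro sum_mono2) auto
  ultimately have "\<eta> * (\<Sum>t=1..T. d t) \<le> window * R + 2 * window * (\<Sum>t=1..T. e t)"
    using split errors by (simp add: algebra_simps)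
  then have "(\<Sum>t=1..T. d t) \<le> (window * R + 2 * window * (\<Sum>t=1..T. e t)) / \<eta>"
    using \<eta> by (simp add: field_simps)
  moreover have "(\<Sum>t=1..T. norm (x i t - x j t)) \<le> (\<Sum>t=1..T. d t)"
    by (intro sum_mono d)
  ultimately show ?thesis by (simp add: e_def \<eta>_def)
qed

end

end

section \<open>Regret and violation of a run\<close>

text \<open>\<open>\<kappa>\<close> and \<open>D\<close> are parameters pinned down by equations so
  that the bounds below are stated with constants that can be chosen before any run is given. The
  multipliers and search directions of the algorithm are substituted into the minimisation
  step.\<close>

locale mirror_descent_run = mixing W E w B
  for W :: "nat \<Rightarrow> real^'n::finite^'n" and E w B +
  fixes X :: "(real^'p) set" and \<psi> :: "real^'p \<Rightarrow> real" and m :: "'n \<Rightarrow> nat"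
    and f :: "'n \<Rightarrow> nat \<Rightarrow> real^'p \<Rightarrow> real" and r :: "nat \<Rightarrow> real^'p \<Rightarrow> real"
    and g :: "'n \<Rightarrow> nat \<Rightarrow> real^'p \<Rightarrow> nat \<Rightarrow> real"
    and \<alpha> \<gamma> :: "nat \<Rightarrow> real" and x z :: "'n \<Rightarrow> nat \<Rightarrow> real^'p"
    and df :: "'n \<Rightarrow> nat \<Rightarrow> real^'p" and dg :: "'n \<Rightarrow> nat \<Rightarrow> nat \<Rightarrow> real^'p"
    and F G1 G2 \<sigma> K c \<gamma>0 \<kappa> D :: real
  assumes pos: "F > 0" "G1 > 0" "G2 > 0" "\<sigma> > 0" "K > 0" "0 < c" "c < 1" "0 < \<gamma>0"
    and \<gamma>0_le: "\<gamma>0 \<le> \<sigma> / (4 * G2\<^sup>2)"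
    and \<kappa>_eq: "\<kappa> = 2 * real (CARD('n) * B) / (w ^ (CARD('n) * B))\<^sup>2"
    and D_eq: "D = sqrt (2 * K / \<sigma>)"
    and psi_diff: "y \<in> X \<Longrightarrow> \<exists>d. GDERIV \<psi> y :> d"
    and psi_strong: "strongly_convex_on X \<psi> \<sigma>"
    and X_convex: "convex X"
    and r_convex: "t \<ge> 1 \<Longrightarrow> convex_on UNIV (r t)"
    and loss_range: "t \<ge> 1 \<Longrightarrow> y \<in> X \<Longrightarrow> y' \<in> X \<Longrightarrow>
      \<bar>local_loss f r i t y - local_loss f r i t y'\<bar> \<le> F"
    and r_subgradient: "t \<ge> 1 \<Longrightarrow> y \<in> X \<Longrightarrow> \<exists>s. subgradient (r t) y s"
    and f_subgradient: "t \<ge> 1 \<Longrightarrow> y \<in> X \<Longrightarrow> \<exists>s. subgradient (f i t) y s"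
    and g_subgradient: "t \<ge> 1 \<Longrightarrow> y \<in> X \<Longrightarrow> \<exists>A. subgradient_matrix (m i) (g i t) y A"
    and loss_subgradient_le: "t \<ge> 1 \<Longrightarrow> y \<in> X \<Longrightarrow> subgradient (f i t) y s \<Longrightarrow>
      subgradient (r t) y s' \<Longrightarrow> norm (s + s') \<le> G1"
    and g_subgradient_le: "t \<ge> 1 \<Longrightarrow> y \<in> X \<Longrightarrow> subgradient_matrix (m i) (g i t) y A \<Longrightarrow>
      matrix_norm2 (m i) A \<le> G2"
    and bregman_convex: "y \<in> X \<Longrightarrow> convex_on X (bregman \<psi> y)"
    and bregman_le: "y \<in> X \<Longrightarrow> y' \<in> X \<Longrightarrow> bregman \<psi> y y' \<le> K"
    and \<alpha>_eq: "t \<ge> 1 \<Longrightarrow> \<alpha> t = 1 / real t powr c"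
    and \<gamma>_eq: "t \<ge> 1 \<Longrightarrow> \<gamma> t = \<gamma>0 / \<alpha> t"
    and z_init: "z i 1 \<in> X"
    and x_mix: "t \<ge> 1 \<Longrightarrow> x i t = (\<Sum>j\<in>UNIV. W t $ i $ j *\<^sub>R z j t)"
    and df: "t \<ge> 1 \<Longrightarrow> subgradient (f i t) (x i t) (df i t)"
    and dg: "t \<ge> 1 \<Longrightarrow> subgradient_matrix (m i) (g i t) (x i t) (dg i t)"
    and z_step: "t \<ge> 1 \<Longrightarrow> is_arg_min
      (\<lambda>y. \<alpha> t * (y \<bullet> (df i t + (\<Sum>k<m i. (\<gamma> t * max 0 (g i t (x i t) k)) *\<^sub>R dg i t k)))
        + \<alpha> t * r t y + bregman \<psi> y (x i t)) (\<lambda>y. y \<in> X) (z i (Suc t))"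
begin

section \<open>Elementary estimates along a run\<close>

abbreviation "loss \<equiv> local_loss f r"

definition viol :: "'n \<Rightarrow> nat \<Rightarrow> real" where
  "viol i t = L2_set (\<lambda>k. max 0 (g i t (x i t) k)) {..<m i}"

definition move :: "'n \<Rightarrow> nat \<Rightarrow> real" where
  "move i t = norm (z i (Suc t) - x i t)"

lemma \<alpha>_pos: "t \<ge> 1 \<Longrightarrow> \<alpha> t > 0"
  and \<alpha>_le_1: "t \<ge> 1 \<Longrightarrow> \<alpha> t \<le> 1"
  using pos by (auto simp: \<alpha>_eq ge_one_powr_ge_zero)

lemma sum_\<alpha>: "T \<ge> 1 \<Longrightarrow> (\<Sum>t=1..T. \<alpha> t) \<le> real T powr (1 - c) / (1 - c)"
  using sum_powr_bound[of c T] pos by (simp add: \<alpha>_eq)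

lemma z_in: "t \<ge> 1 \<Longrightarrow> z i t \<in> X"
proof (cases "t = 1")
  case False
  moreover assume "t \<ge> 1"
  ultimately show ?thesis using z_step[of "t - 1" i] by (simp add: is_arg_min_def)
qed (use z_init in simp)

lemma x_in: "t \<ge> 1 \<Longrightarrow> x i t \<in> X"
  unfolding x_mix by (intro convex_sum X_convex) (auto simp: W_row W_nonneg z_in)

lemma bregman_lower: "y \<in> X \<Longrightarrow> y' \<in> X \<Longrightarrow> \<sigma> / 2 * (norm (y - y'))\<^sup>2 \<le> bregman \<psi> y y'"
  using psi_strong by (auto simp: strongly_convex_on_def bregman_def algebra_simps)

lemma bregman_nonneg: "y \<in> X \<Longrightarrow> y' \<in> X \<Longrightarrow> 0 \<le> bregman \<psi> y y'"
  using order_trans[OF _ bregman_lower[of y y'], of 0] pos by simp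

lemma norm_diff_le_D: "y \<in> X \<Longrightarrow> y' \<in> X \<Longrightarrow> norm (y - y') \<le> D"
  using order_trans[OF bregman_lower bregman_le, of y y'] pos
  by (auto simp: D_eq field_simps intro!: real_le_rsqrt)

lemma consensus:
  "(\<Sum>t=1..T. norm (x i t - x j t)) \<le> \<kappa> * (D + (\<Sum>t=1..T. \<Sum>i\<in>UNIV. move i t))"
proof -
  have D: "D \<ge> 0" using pos by (simp add: D_eq)
  have "(\<Sum>t=1..T. norm (x i t - x j t))
      \<le> (window * D + 2 * window * (\<Sum>t=1..T. \<Sum>i\<in>UNIV. move i t)) / (w ^ window)\<^sup>2"
    unfolding move_def by (rule consensus_sum[OF x_mix norm_diff_le_D[OF x_in x_in]])
  \<comment> \<open>Doubling the first term lets the single factor \<open>\<kappa>\<close> serve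
    both.\<close>
  also have "\<dots> \<le> (2 * window * D + 2 * window * (\<Sum>t=1..T. \<Sum>i\<in>UNIV. move i t)) / (w ^ window)\<^sup>2"
    using D by (intro divide_right_mono add_right_mono mult_right_mono) auto
  finally show ?thesis by (simp add: \<kappa>_eq window_def algebra_simps add_divide_distrib)
qed

text \<open>The bound \<open>G1\<close> concerns the sum of a subgradient of \<open>f\<close> and
  one of \<open>r\<close>, so the two inequalities are added before Cauchy-Schwarz is
  applied.\<close>

lemma loss_lipschitz:
  assumes "t \<ge> 1" "y \<in> X" "y' \<in> X"
  shows "loss i t y \<le> loss i t y' + G1 * norm (y - y')"
proof -
  obtain s s' where s: "subgradient (f i t) y s" "subgradient (r t) y s'"
    using f_subgradient r_subgradient assms by meson
  then have "f i t y' \<ge> f i t y + s \<bullet> (y' - y)" "r t y' \<ge> r t y + s' \<bullet> (y' - y)"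
    by (auto simp: subgradient_def)
  then have "loss i t y \<le> loss i t y' + (s + s') \<bullet> (y - y')"
    by (simp add: local_loss_def inner_simps algebra_simps)
  also have "(s + s') \<bullet> (y - y') \<le> norm (s + s') * norm (y - y')" by (rule norm_cauchy_schwarz)
  also have "\<dots> \<le> G1 * norm (y - y')"
    using loss_subgradient_le s assms by (intro mult_right_mono) auto
  finally show ?thesis by simp
qed

lemma g_norm_lipschitz:
  assumes "t \<ge> 1" "y \<in> X"
  shows "L2_set (\<lambda>k. max 0 (g i t y k)) {..<m i}
    \<le> L2_set (\<lambda>k. max 0 (g i t y' k)) {..<m i} + G2 * norm (y - y')"
proof -
  obtain A where A: "subgradient_matrix (m i) (g i t) y A" using g_subgradient assms by blast
  have "max 0 (g i t y k) \<le> max 0 (g i t y' k) + \<bar>A k \<bullet> (y - y')\<bar>" if "k < m i" for k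
  proof -
    have "g i t y' k \<ge> g i t y k + A k \<bullet> (y' - y)"
      using A that by (auto simp: subgradient_matrix_def subgradient_def)
    then show ?thesis by (simp add: inner_simps)
  qed
  then have "L2_set (\<lambda>k. max 0 (g i t y k)) {..<m i}
      \<le> L2_set (\<lambda>k. max 0 (g i t y' k) + \<bar>A k \<bullet> (y - y')\<bar>) {..<m i}"
    by (intro L2_set_mono) auto
  also have "\<dots> \<le> L2_set (\<lambda>k. max 0 (g i t y' k)) {..<m i} + L2_set (\<lambda>k. \<bar>A k \<bullet> (y - y')\<bar>) {..<m i}"
    by (rule L2_set_triangle_ineq)
  also have "L2_set (\<lambda>k. \<bar>A k \<bullet> (y - y')\<bar>) {..<m i} \<le> matrix_norm2 (m i) A * norm (y - y')"
    using matrix_norm2_bound[of A "y - y'" "m i"] by (simp add: L2_set_def)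
  also have "\<dots> \<le> G2 * norm (y - y')"
    using g_subgradient_le A assms by (intro mult_right_mono) auto
  finally show ?thesis by simp
qed

text \<open>The three-point inequality with \<open>h\<close> made of the linearised loss, the
  penalty and \<open>r\<close>. Because \<open>\<alpha> t * \<gamma> t\<close> is the constant
  \<open>\<gamma>0\<close>, the squared violation keeps a fixed weight in every round.\<close>

lemma local_step:
  assumes t: "t \<ge> 1" and y: "y \<in> X" and feas: "\<And>k. k < m i \<Longrightarrow> g i t y k \<le> 0"
  shows "\<alpha> t * (loss i t (x i t) - loss i t y) + \<gamma>0 / 2 * (viol i t)\<^sup>2 + \<sigma> / 4 * (move i t)\<^sup>2
    \<le> bregman \<psi> y (x i t) - bregman \<psi> y (z i (Suc t)) + 2 * G1\<^sup>2 / \<sigma> * (\<alpha> t)\<^sup>2"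
proof -
  let ?x = "x i t" and ?z = "z i (Suc t)" and ?v = "viol i t" and ?d = "move i t"
  define q where "q k = \<gamma> t * max 0 (g i t ?x k)" for k
  define h where "h u = \<alpha> t * (u \<bullet> (df i t + (\<Sum>k<m i. q k *\<^sub>R dg i t k))) + \<alpha> t * r t u" for u
  have x: "?x \<in> X" and z: "?z \<in> X" using t x_in z_in by auto
  have \<alpha>: "\<alpha> t > 0" and \<gamma>: "\<gamma> t > 0" and \<alpha>\<gamma>: "\<alpha> t * \<gamma> t = \<gamma>0"
    using \<alpha>_pos t pos by (auto simp: \<gamma>_eq) (use \<alpha>_pos[OF t] in simp)
  have v: "?v \<ge> 0" and d: "?d \<ge> 0" by (auto simp: viol_def move_def L2_set_nonneg)
  have "convex_on X (\<lambda>u. u \<bullet> a)" for a :: "real^'p"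
    using X_convex by (simp add: convex_on_def inner_simps)
  then have "convex_on X h" unfolding h_def
    using \<alpha> r_convex[OF t] convex_on_subset[of UNIV "r t" X] X_convex
    by (intro convex_on_add convex_on_cmul) auto
  moreover obtain d' where "GDERIV \<psi> ?z :> d'" using psi_diff z by blast
  moreover have "is_arg_min (\<lambda>u. h u + bregman \<psi> u ?x) (\<lambda>u. u \<in> X) ?z"
    using z_step[OF t, of i] by (simp add: h_def q_def)
  ultimately have step: "h ?z - h y \<le> bregman \<psi> y ?x - bregman \<psi> y ?z - bregman \<psi> ?z ?x"
    using X_convex y by (intro mirror_step)
  obtain s' where s': "subgradient (r t) ?x s'" using r_subgradient t x by blast
  \<comment> \<open>\<open>f\<close> is linearised at \<open>?x\<close> while \<open>r\<close> is
    evaluated at \<open>?z\<close>. A subgradient of \<open>r\<close> at \<open>?x\<close> brings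
    \<open>r\<close> back to \<open>?x\<close>, and then only the combined subgradient, bounded by
    \<open>G1\<close>, meets the move.\<close>
  have loss_part: "(?z - y) \<bullet> df i t + r t ?z - r t y \<ge> loss i t ?x - loss i t y - G1 * ?d"
  proof -
    have "f i t y \<ge> f i t ?x + df i t \<bullet> (y - ?x)" "r t ?z \<ge> r t ?x + s' \<bullet> (?z - ?x)"
      using df[OF t, of i] s' by (auto simp: subgradient_def)
    moreover have "- (G1 * ?d) \<le> (df i t + s') \<bullet> (?z - ?x)"
    proof -
      have "\<bar>(df i t + s') \<bullet> (?z - ?x)\<bar> \<le> norm (df i t + s') * ?d"
        unfolding move_def by (rule Cauchy_Schwarz_ineq2)
      also have "\<dots> \<le> G1 * ?d"
        using loss_subgradient_le[OF t x df[OF t] s'] d by (rule mult_right_mono)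
      finally show ?thesis by linarith
    qed
    ultimately show ?thesis by (simp add: local_loss_def inner_simps inner_commute algebra_simps)
  qed
  \<comment> \<open>\<open>?z - y\<close> is split at \<open>?x\<close>. The part
    \<open>?x - y\<close> yields the squared violation, since \<open>y\<close> is feasible and
    \<open>q k\<close> vanishes where the constraint holds; the part \<open>?z - ?x\<close> is an
    error of the size of the move.\<close>
  have constraint_part: "(\<Sum>k<m i. q k * ((?z - y) \<bullet> dg i t k)) \<ge> \<gamma> t * ?v\<^sup>2 - \<gamma> t * ?v * (G2 * ?d)"
  proof -
    have "q k * ((?x - y) \<bullet> dg i t k) \<ge> \<gamma> t * (max 0 (g i t ?x k))\<^sup>2" if "k < m i" for k
    proof -
      have "g i t y k \<ge> g i t ?x k + dg i t k \<bullet> (y - ?x)"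
        using dg[OF t, of i] that by (auto simp: subgradient_matrix_def subgradient_def)
      then have "(?x - y) \<bullet> dg i t k \<ge> g i t ?x k"
        using feas[OF that] by (simp add: inner_simps inner_commute)
      then have "q k * ((?x - y) \<bullet> dg i t k) \<ge> q k * g i t ?x k"
        using \<gamma> by (intro mult_left_mono) (auto simp: q_def)
      moreover have "q k * g i t ?x k = \<gamma> t * (max 0 (g i t ?x k))\<^sup>2"
        by (simp add: q_def max_def power2_eq_square)
      ultimately show ?thesis by simp
    qed
    then have "(\<Sum>k<m i. q k * ((?x - y) \<bullet> dg i t k)) \<ge> (\<Sum>k<m i. \<gamma> t * (max 0 (g i t ?x k))\<^sup>2)"
      by (intro sum_mono) auto
    also have "(\<Sum>k<m i. \<gamma> t * (max 0 (g i t ?x k))\<^sup>2) = \<gamma> t * ?v\<^sup>2"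
      by (simp add: viol_def L2_set_def sum_nonneg sum_distrib_left)
    finally have 1: "(\<Sum>k<m i. q k * ((?x - y) \<bullet> dg i t k)) \<ge> \<gamma> t * ?v\<^sup>2" .
    have "\<bar>\<Sum>k<m i. q k * ((?z - ?x) \<bullet> dg i t k)\<bar> \<le> (\<Sum>k<m i. \<bar>q k\<bar> * \<bar>dg i t k \<bullet> (?z - ?x)\<bar>)"
      by (rule order_trans[OF sum_abs]) (simp add: abs_mult inner_commute)
    also have "\<dots> \<le> L2_set q {..<m i} * L2_set (\<lambda>k. dg i t k \<bullet> (?z - ?x)) {..<m i}"
      by (rule L2_set_mult_ineq)
    also have "L2_set q {..<m i} = \<gamma> t * ?v"
      using \<gamma> by (simp add: q_def[abs_def] viol_def L2_set_right_distrib)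
    also have "L2_set (\<lambda>k. dg i t k \<bullet> (?z - ?x)) {..<m i} \<le> matrix_norm2 (m i) (dg i t) * ?d"
      unfolding move_def by (rule matrix_norm2_bound)
    also have "matrix_norm2 (m i) (dg i t) * ?d \<le> G2 * ?d"
      using g_subgradient_le[OF t x dg[OF t]] d by (rule mult_right_mono)
    finally have "\<bar>\<Sum>k<m i. q k * ((?z - ?x) \<bullet> dg i t k)\<bar> \<le> \<gamma> t * ?v * (G2 * ?d)"
      using \<gamma> v by (simp add: mult_left_mono)
    moreover have "(\<Sum>k<m i. q k * ((?z - y) \<bullet> dg i t k))
        = (\<Sum>k<m i. q k * ((?x - y) \<bullet> dg i t k)) + (\<Sum>k<m i. q k * ((?z - ?x) \<bullet> dg i t k))"
      by (simp add: sum.distrib[symmetric] inner_simps algebra_simps)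
    ultimately show ?thesis using 1 by linarith
  qed
  have "h ?z - h y = \<alpha> t * (((?z - y) \<bullet> df i t + r t ?z - r t y) + (\<Sum>k<m i. q k * ((?z - y) \<bullet> dg i t k)))"
    by (simp add: h_def inner_add_right inner_sum_right inner_diff_left sum_subtractf algebra_simps)
  also have "\<dots> \<ge> \<alpha> t * ((loss i t ?x - loss i t y - G1 * ?d) + (\<gamma> t * ?v\<^sup>2 - \<gamma> t * ?v * (G2 * ?d)))"
    using loss_part constraint_part \<alpha> by (intro mult_left_mono) auto
  also have "\<alpha> t * ((loss i t ?x - loss i t y - G1 * ?d) + (\<gamma> t * ?v\<^sup>2 - \<gamma> t * ?v * (G2 * ?d)))
      = \<alpha> t * (loss i t ?x - loss i t y) - \<alpha> t * G1 * ?d + (\<alpha> t * \<gamma> t) * ?v\<^sup>2 - (\<alpha> t * \<gamma> t) * ?v * (G2 * ?d)"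
    by (simp add: algebra_simps)
  finally have main: "\<alpha> t * (loss i t ?x - loss i t y) - \<alpha> t * G1 * ?d + \<gamma>0 * ?v\<^sup>2 - \<gamma>0 * ?v * (G2 * ?d)
      \<le> bregman \<psi> y ?x - bregman \<psi> y ?z - bregman \<psi> ?z ?x"
    using step by (simp add: \<alpha>\<gamma>)
  have young1: "\<alpha> t * G1 * ?d \<le> \<sigma> / 8 * ?d\<^sup>2 + 2 * G1\<^sup>2 / \<sigma> * (\<alpha> t)\<^sup>2"
  proof -
    have "0 \<le> \<sigma> / 8 * (?d - 4 * \<alpha> t * G1 / \<sigma>)\<^sup>2" using pos by simp
    also have "\<dots> = \<sigma> / 8 * ?d\<^sup>2 - \<alpha> t * G1 * ?d + 2 * G1\<^sup>2 / \<sigma> * (\<alpha> t)\<^sup>2"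
      using pos by (simp add: power2_eq_square field_simps)
    finally show ?thesis by simp
  qed
  \<comment> \<open>The bound on \<open>\<gamma>0\<close> keeps the cost of this square at
    \<open>\<sigma> / 8\<close>.\<close>
  have young2: "\<gamma>0 * ?v * (G2 * ?d) \<le> \<gamma>0 / 2 * ?v\<^sup>2 + \<sigma> / 8 * ?d\<^sup>2"
  proof -
    have "0 \<le> \<gamma>0 / 2 * (?v - G2 * ?d)\<^sup>2" using pos by simp
    also have "\<dots> = \<gamma>0 / 2 * ?v\<^sup>2 + (\<gamma>0 * G2\<^sup>2) / 2 * ?d\<^sup>2 - \<gamma>0 * ?v * (G2 * ?d)"
      by (simp add: power2_eq_square field_simps)
    also have "(\<gamma>0 * G2\<^sup>2) / 2 * ?d\<^sup>2 \<le> (\<sigma> / 4) / 2 * ?d\<^sup>2"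
      using \<gamma>0_le pos by (intro mult_right_mono divide_right_mono) (auto simp: field_simps)
    finally show ?thesis by simp
  qed
  \<comment> \<open>Strong convexity supplies \<open>\<sigma> / 2\<close>: one eighth pays for each
    use of Young's inequality and the remaining quarter survives in the claim.\<close>
  have "\<sigma> / 2 * ?d\<^sup>2 \<le> bregman \<psi> ?z ?x" unfolding move_def using z x by (rule bregman_lower)
  moreover have "\<sigma> / 2 * ?d\<^sup>2 = \<sigma> / 8 * ?d\<^sup>2 + \<sigma> / 8 * ?d\<^sup>2 + \<sigma> / 4 * ?d\<^sup>2"
    "\<gamma>0 * ?v\<^sup>2 = \<gamma>0 / 2 * ?v\<^sup>2 + \<gamma>0 / 2 * ?v\<^sup>2" by auto
  ultimately show ?thesis using main young1 young2 by linarith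
qed

text \<open>Convexity of the divergence in its second argument and the unit column sums bound its
  total at the \<open>x i t\<close> by its total at the \<open>z i t\<close>, so that the right-hand
  side telescopes.\<close>

lemma network_step:
  assumes t: "t \<ge> 1" and y: "y \<in> X" and feas: "\<And>i k. k < m i \<Longrightarrow> g i t y k \<le> 0"
  shows "\<alpha> t * (\<Sum>i\<in>UNIV. loss i t (x i t) - loss i t y)
      + \<gamma>0 / 2 * (\<Sum>i\<in>UNIV. (viol i t)\<^sup>2) + \<sigma> / 4 * (\<Sum>i\<in>UNIV. (move i t)\<^sup>2)
    \<le> (\<Sum>i\<in>UNIV. bregman \<psi> y (z i t)) - (\<Sum>i\<in>UNIV. bregman \<psi> y (z i (Suc t)))
      + CARD('n) * (2 * G1\<^sup>2 / \<sigma>) * (\<alpha> t)\<^sup>2"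
proof -
  have "(\<Sum>i\<in>UNIV. bregman \<psi> y (x i t)) \<le> (\<Sum>i\<in>UNIV. \<Sum>j\<in>UNIV. W t $ i $ j * bregman \<psi> y (z j t))"
    unfolding x_mix[OF t] using t
    by (intro sum_mono convex_on_sum[OF _ _ bregman_convex[OF y]]) (auto simp: W_row W_nonneg z_in)
  also have "\<dots> = (\<Sum>j\<in>UNIV. (\<Sum>i\<in>UNIV. W t $ i $ j) * bregman \<psi> y (z j t))"
    unfolding sum_distrib_right by (rule sum.swap)
  finally have "(\<Sum>i\<in>UNIV. bregman \<psi> y (x i t)) \<le> (\<Sum>i\<in>UNIV. bregman \<psi> y (z i t))"
    using t by (simp add: W_col)
  moreover have "(\<Sum>i\<in>UNIV. \<alpha> t * (loss i t (x i t) - loss i t y) + \<gamma>0 / 2 * (viol i t)\<^sup>2 + \<sigma> / 4 * (move i t)\<^sup>2)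
    \<le> (\<Sum>i\<in>UNIV. bregman \<psi> y (x i t) - bregman \<psi> y (z i (Suc t)) + 2 * G1\<^sup>2 / \<sigma> * (\<alpha> t)\<^sup>2)"
    by (intro sum_mono local_step assms)
  ultimately show ?thesis
    by (simp add: sum.distrib sum_subtractf sum_distrib_left[symmetric] sum_divide_distrib[symmetric])
qed

text \<open>Division by \<open>\<alpha> t\<close> gives the potential differences the nondecreasing
  weight \<open>t powr c\<close>, to which \<open>abel_sum_bound\<close> applies. The squared moves
  are kept, with weight growing like \<open>1 / \<alpha> t\<close>, to pay for disagreement
  later.\<close>

lemma weighted_regret:
  assumes y: "y \<in> feasible X m g T" and T: "T \<ge> 1"
  shows "(\<Sum>t=1..T. \<Sum>i\<in>UNIV. loss i t (x i t) - loss i t y) + (\<Sum>t=1..T. \<Sum>i\<in>UNIV. \<sigma> / (4 * \<alpha> t) * (move i t)\<^sup>2)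
    \<le> CARD('n) * K * real T powr c + CARD('n) * (2 * G1\<^sup>2 / \<sigma>) * (\<Sum>t=1..T. \<alpha> t)"
proof -
  let ?\<Phi> = "\<lambda>t. \<Sum>i\<in>UNIV. bregman \<psi> y (z i t)"
  have yX: "y \<in> X" using y by (simp add: feasible_def)
  have step: "(\<Sum>i\<in>UNIV. loss i t (x i t) - loss i t y) + (\<Sum>i\<in>UNIV. \<sigma> / (4 * \<alpha> t) * (move i t)\<^sup>2)
      \<le> (?\<Phi> t - ?\<Phi> (Suc t)) * real t powr c + CARD('n) * (2 * G1\<^sup>2 / \<sigma>) * \<alpha> t" if t: "t \<in> {1..T}" for t
  proof -
    have a: "\<alpha> t > 0" using t by (simp add: \<alpha>_pos)
    have "\<alpha> t * (\<Sum>i\<in>UNIV. loss i t (x i t) - loss i t y) + \<sigma> / 4 * (\<Sum>i\<in>UNIV. (move i t)\<^sup>2)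
        \<le> ?\<Phi> t - ?\<Phi> (Suc t) + CARD('n) * (2 * G1\<^sup>2 / \<sigma>) * (\<alpha> t)\<^sup>2"
    proof -
      have "0 \<le> \<gamma>0 / 2 * (\<Sum>i\<in>UNIV. (viol i t)\<^sup>2)"
        using pos by (simp add: sum_nonneg)
      moreover have "g i t y k \<le> 0" if "k < m i" for i k
        using y t that by (auto simp: feasible_def)
      ultimately show ?thesis using network_step[of t y] t yX by fastforce
    qed
    then have "(\<alpha> t * (\<Sum>i\<in>UNIV. loss i t (x i t) - loss i t y) + \<sigma> / 4 * (\<Sum>i\<in>UNIV. (move i t)\<^sup>2)) / \<alpha> t
        \<le> (?\<Phi> t - ?\<Phi> (Suc t) + CARD('n) * (2 * G1\<^sup>2 / \<sigma>) * (\<alpha> t)\<^sup>2) / \<alpha> t"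
      using a by (intro divide_right_mono) auto
    also have "\<dots> = (?\<Phi> t - ?\<Phi> (Suc t)) * (1 / \<alpha> t) + CARD('n) * (2 * G1\<^sup>2 / \<sigma>) * \<alpha> t"
      using a by (simp add: add_divide_distrib power2_eq_square)
    also have "1 / \<alpha> t = real t powr c" using t by (simp add: \<alpha>_eq)
    finally show ?thesis
      using a by (simp add: add_divide_distrib sum_distrib_left[symmetric] sum_divide_distrib[symmetric])
  qed
  have "(\<Sum>t=1..T. \<Sum>i\<in>UNIV. loss i t (x i t) - loss i t y) + (\<Sum>t=1..T. \<Sum>i\<in>UNIV. \<sigma> / (4 * \<alpha> t) * (move i t)\<^sup>2)
      \<le> (\<Sum>t=1..T. (?\<Phi> t - ?\<Phi> (Suc t)) * real t powr c) + CARD('n) * (2 * G1\<^sup>2 / \<sigma>) * (\<Sum>t=1..T. \<alpha> t)"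
    unfolding sum.distrib[of _ _ "{1..T}", symmetric] sum_distrib_left[of _ _ "{1..T}"]
    by (rule sum_mono) (rule step)
  moreover have "(\<Sum>t=1..T. (?\<Phi> t - ?\<Phi> (Suc t)) * real t powr c) \<le> CARD('n) * K * real T powr c"
  proof (rule abel_sum_bound)
    fix t :: nat assume t: "t \<ge> 1"
    show "0 \<le> ?\<Phi> t" using t yX by (intro sum_nonneg bregman_nonneg z_in)
    show "?\<Phi> t \<le> CARD('n) * K"
      using t yX sum_bounded_above[of UNIV "\<lambda>i. bregman \<psi> y (z i t)" K] by (simp add: bregman_le z_in)
    show "real t powr c \<le> real (Suc t) powr c" using t pos by (intro powr_mono2) auto
  qed (use T in auto)
  ultimately show ?thesis by linarith
qed

text \<open>Evaluating agent \<open>j\<close>'s loss at \<open>x i t\<close> instead of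
  \<open>x j t\<close> costs \<open>G1\<close> times their distance. By \<open>consensus\<close>
  these costs are linear in the moves, and the squares kept in \<open>weighted_regret\<close> absorb
  them.\<close>

lemma regret_vs_feasible:
  assumes y: "y \<in> feasible X m g T" and T: "T \<ge> 1"
  shows "(\<Sum>t=1..T. global_loss f r t (x i t)) - (\<Sum>t=1..T. global_loss f r t y)
    \<le> (K + (2 * G1\<^sup>2 / \<sigma> + (G1 * CARD('n) * \<kappa>)\<^sup>2 / \<sigma>) / (1 - c) + G1 * \<kappa> * D) * real T powr (max c (1 - c))"
proof -
  define N where "N = real CARD('n)"
  have N: "N > 0" by (simp add: N_def)
  have \<kappa>: "\<kappa> \<ge> 0" by (simp add: \<kappa>_eq)
  have D: "D \<ge> 0" using pos by (simp add: D_eq)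
  have 1: "N * (global_loss f r t (x i t) - global_loss f r t y)
      \<le> (\<Sum>j\<in>UNIV. loss j t (x j t) - loss j t y) + G1 * (\<Sum>j\<in>UNIV. norm (x i t - x j t))"
    if t: "t \<in> {1..T}" for t
  proof -
    have "(\<Sum>j\<in>UNIV. loss j t (x i t)) \<le> (\<Sum>j\<in>UNIV. loss j t (x j t) + G1 * norm (x i t - x j t))"
      using t by (intro sum_mono loss_lipschitz x_in) auto
    then show ?thesis
      by (simp add: global_loss_def N_def right_diff_distrib sum.distrib sum_subtractf sum_distrib_left[symmetric])
  qed
  have "N * ((\<Sum>t=1..T. global_loss f r t (x i t)) - (\<Sum>t=1..T. global_loss f r t y))
      = (\<Sum>t=1..T. N * (global_loss f r t (x i t) - global_loss f r t y))"
    by (simp add: sum_subtractf sum_distrib_left right_diff_distrib)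
  also have "\<dots> \<le> (\<Sum>t=1..T. (\<Sum>j\<in>UNIV. loss j t (x j t) - loss j t y) + G1 * (\<Sum>j\<in>UNIV. norm (x i t - x j t)))"
    by (intro sum_mono 1)
  also have "\<dots> = (\<Sum>t=1..T. \<Sum>j\<in>UNIV. loss j t (x j t) - loss j t y) + G1 * (\<Sum>t=1..T. \<Sum>j\<in>UNIV. norm (x i t - x j t))"
    unfolding sum.distrib sum_distrib_left ..
  also have "(\<Sum>t=1..T. \<Sum>j\<in>UNIV. norm (x i t - x j t)) = (\<Sum>j\<in>UNIV. \<Sum>t=1..T. norm (x i t - x j t))"
    by (rule sum.swap)
  also have "\<dots> \<le> (\<Sum>j\<in>(UNIV::'n set). \<kappa> * (D + (\<Sum>t=1..T. \<Sum>i\<in>UNIV. move i t)))"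
    by (intro sum_mono consensus)
  also have "\<dots> = N * \<kappa> * (D + (\<Sum>t=1..T. \<Sum>i\<in>UNIV. move i t))"
    by (simp add: N_def)
  finally have "N * ((\<Sum>t=1..T. global_loss f r t (x i t)) - (\<Sum>t=1..T. global_loss f r t y))
      \<le> (\<Sum>t=1..T. \<Sum>j\<in>UNIV. loss j t (x j t) - loss j t y)
        + N * G1 * \<kappa> * D + (\<Sum>t=1..T. \<Sum>i\<in>UNIV. G1 * N * \<kappa> * move i t)"
    using pos by (simp add: sum_distrib_left[symmetric] algebra_simps)
  \<comment> \<open>Completing the square with weight \<open>\<sigma> / (4 * \<alpha> t)\<close>
    matches the available term exactly and leaves a multiple of \<open>\<alpha> t\<close>, which has
    the summable order already present.\<close>
  also have "(\<Sum>t=1..T. \<Sum>i\<in>UNIV. G1 * N * \<kappa> * move i t)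
      \<le> (\<Sum>t=1..T. \<Sum>i\<in>(UNIV::'n set). \<sigma> / (4 * \<alpha> t) * (move i t)\<^sup>2 + (G1 * N * \<kappa>)\<^sup>2 / \<sigma> * \<alpha> t)"
  proof (intro sum_mono)
    fix t j assume "t \<in> {1..T}"
    then have a: "\<alpha> t > 0" by (simp add: \<alpha>_pos)
    have "0 \<le> \<sigma> / (4 * \<alpha> t) * (move j t - 2 * \<alpha> t / \<sigma> * (G1 * N * \<kappa>))\<^sup>2" using a pos by simp
    also have "\<dots> = \<sigma> / (4 * \<alpha> t) * (move j t)\<^sup>2 + (G1 * N * \<kappa>)\<^sup>2 / \<sigma> * \<alpha> t - (G1 * N * \<kappa>) * move j t"
      unfolding power2_eq_square using a pos by (simp add: field_simps)
    finally show "G1 * N * \<kappa> * move j t \<le> \<sigma> / (4 * \<alpha> t) * (move j t)\<^sup>2 + (G1 * N * \<kappa>)\<^sup>2 / \<sigma> * \<alpha> t"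
      by simp
  qed
  also have "\<dots> = (\<Sum>t=1..T. \<Sum>i\<in>UNIV. \<sigma> / (4 * \<alpha> t) * (move i t)\<^sup>2) + N * ((G1 * N * \<kappa>)\<^sup>2 / \<sigma>) * (\<Sum>t=1..T. \<alpha> t)"
    by (simp add: sum.distrib N_def sum_distrib_left mult.assoc)
  finally have "N * ((\<Sum>t=1..T. global_loss f r t (x i t)) - (\<Sum>t=1..T. global_loss f r t y))
      \<le> N * (K * real T powr c + (2 * G1\<^sup>2 / \<sigma> + (G1 * N * \<kappa>)\<^sup>2 / \<sigma>) * (\<Sum>t=1..T. \<alpha> t) + G1 * \<kappa> * D)"
    using weighted_regret[OF y T] unfolding N_def[symmetric] by (simp add: algebra_simps)
  then have "(\<Sum>t=1..T. global_loss f r t (x i t)) - (\<Sum>t=1..T. global_loss f r t y)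
      \<le> K * real T powr c + (2 * G1\<^sup>2 / \<sigma> + (G1 * N * \<kappa>)\<^sup>2 / \<sigma>) * (\<Sum>t=1..T. \<alpha> t) + G1 * \<kappa> * D"
    using N by simp
  also have "\<dots> \<le> K * real T powr (max c (1 - c))
      + (2 * G1\<^sup>2 / \<sigma> + (G1 * N * \<kappa>)\<^sup>2 / \<sigma>) * (real T powr (max c (1 - c)) / (1 - c))
      + G1 * \<kappa> * D * real T powr (max c (1 - c))"
  proof (intro add_mono mult_left_mono)
    show "real T powr c \<le> real T powr (max c (1 - c))" using T by (intro powr_mono) auto
    have "real T powr (1 - c) / (1 - c) \<le> real T powr (max c (1 - c)) / (1 - c)"
      using T pos by (intro divide_right_mono powr_mono) auto
    then show "(\<Sum>t=1..T. \<alpha> t) \<le> real T powr (max c (1 - c)) / (1 - c)"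
      using sum_\<alpha>[OF T] by linarith
    have "1 \<le> real T powr (max c (1 - c))" using T pos by (intro ge_one_powr_ge_zero) auto
    then show "G1 * \<kappa> * D \<le> G1 * \<kappa> * D * real T powr (max c (1 - c))"
      using pos \<kappa> D mult_left_mono[of 1 "real T powr (max c (1 - c))" "G1 * \<kappa> * D"] by simp
  qed (use pos in auto)
  finally show ?thesis by (simp add: N_def algebra_simps add_divide_distrib)
qed

text \<open>The bound is the same for every feasible comparator, so it passes to the
  infimum.\<close>

lemma net_regret_bound:
  assumes T: "T \<ge> 1" and ne: "feasible X m g T \<noteq> {}"
  shows "net_regret X m f r g x T
    \<le> (K + (2 * G1\<^sup>2 / \<sigma> + (G1 * CARD('n) * \<kappa>)\<^sup>2 / \<sigma>) / (1 - c) + G1 * \<kappa> * D) * real T powr (max c (1 - c))"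
    (is "_ \<le> ?b")
proof -
  have "(\<Sum>t=1..T. global_loss f r t (x i t)) - ?b
      \<le> (INF y\<in>feasible X m g T. \<Sum>t=1..T. global_loss f r t y)" for i
    using ne
  proof (rule cINF_greatest)
    fix y assume "y \<in> feasible X m g T"
    from regret_vs_feasible[OF this T, of i]
    show "(\<Sum>t=1..T. global_loss f r t (x i t)) - ?b \<le> (\<Sum>t=1..T. global_loss f r t y)" by linarith
  qed
  then have "(\<Sum>t=1..T. global_loss f r t (x i t)) - (INF y\<in>feasible X m g T. \<Sum>t=1..T. global_loss f r t y) \<le> ?b" for i
    by (simp add: algebra_simps)
  then have "(\<Sum>i\<in>(UNIV::'n set). (\<Sum>t=1..T. global_loss f r t (x i t))
      - (INF y\<in>feasible X m g T. \<Sum>t=1..T. global_loss f r t y)) \<le> CARD('n) * ?b"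
    by (intro sum_bounded_above)
  then show ?thesis by (simp add: net_regret_def field_simps)
qed

text \<open>Without division by \<open>\<alpha> t\<close>, any one feasible comparator will do: its
  loss differences are at least \<open>- F\<close>, which costs a multiple of
  \<open>\<alpha> t\<close> per round, and the potential telescopes with weight 1.\<close>

lemma square_sums:
  assumes T: "T \<ge> 1" and ne: "feasible X m g T \<noteq> {}"
    and M: "M = CARD('n) * (K + (F + 2 * G1\<^sup>2 / \<sigma>) / (1 - c))"
  shows "(\<Sum>t=1..T. \<Sum>i\<in>UNIV. (viol i t)\<^sup>2) \<le> 2 * M / \<gamma>0 * real T powr (1 - c)"
    and "(\<Sum>t=1..T. \<Sum>i\<in>UNIV. (move i t)\<^sup>2) \<le> 4 * M / \<sigma> * real T powr (1 - c)"
proof -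
  define N where "N = real CARD('n)"
  obtain y where y: "y \<in> feasible X m g T" using ne by blast
  then have yX: "y \<in> X" by (simp add: feasible_def)
  let ?\<Phi> = "\<lambda>t. \<Sum>i\<in>UNIV. bregman \<psi> y (z i t)"
  define V where "V = (\<Sum>t=1..T. \<Sum>i\<in>UNIV. (viol i t)\<^sup>2)"
  define S where "S = (\<Sum>t=1..T. \<Sum>i\<in>UNIV. (move i t)\<^sup>2)"
  have step: "\<gamma>0 / 2 * (\<Sum>i\<in>UNIV. (viol i t)\<^sup>2) + \<sigma> / 4 * (\<Sum>i\<in>UNIV. (move i t)\<^sup>2)
      \<le> (?\<Phi> t - ?\<Phi> (Suc t)) * 1 + N * (F + 2 * G1\<^sup>2 / \<sigma>) * \<alpha> t" if t: "t \<in> {1..T}" for t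
  proof -
    have a: "\<alpha> t > 0" "\<alpha> t \<le> 1" using t by (auto simp: \<alpha>_pos \<alpha>_le_1)
    have "- F \<le> loss i t (x i t) - loss i t y" for i
      using loss_range[of t "x i t" y i] t yX x_in by force
    then have "(\<Sum>i\<in>(UNIV::'n set). - F) \<le> (\<Sum>i\<in>UNIV. loss i t (x i t) - loss i t y)" by (intro sum_mono)
    then have "\<alpha> t * - (N * F) \<le> \<alpha> t * (\<Sum>i\<in>UNIV. loss i t (x i t) - loss i t y)"
      using a by (intro mult_left_mono) (auto simp: N_def)
    moreover have "N * (2 * G1\<^sup>2 / \<sigma>) * (\<alpha> t)\<^sup>2 \<le> N * (2 * G1\<^sup>2 / \<sigma>) * \<alpha> t"
      using a pos by (intro mult_left_mono) (auto simp: N_def power2_eq_square mult_left_le)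
    moreover have "g i t y k \<le> 0" if "k < m i" for i k
      using y t that by (auto simp: feasible_def)
    ultimately show ?thesis
      using network_step[of t y] t yX by (simp add: N_def algebra_simps)
  qed
  have "\<gamma>0 / 2 * V + \<sigma> / 4 * S \<le> (\<Sum>t=1..T. (?\<Phi> t - ?\<Phi> (Suc t)) * 1) + N * (F + 2 * G1\<^sup>2 / \<sigma>) * (\<Sum>t=1..T. \<alpha> t)"
    unfolding V_def S_def sum_distrib_left[of _ _ "{1..T}"] sum.distrib[of _ _ "{1..T}", symmetric] by (rule sum_mono) (rule step)
  also have "(\<Sum>t=1..T. (?\<Phi> t - ?\<Phi> (Suc t)) * 1) \<le> N * K * 1"
  proof (rule abel_sum_bound)
    fix t :: nat assume t: "t \<ge> 1"
    show "0 \<le> ?\<Phi> t" using t yX by (intro sum_nonneg bregman_nonneg z_in)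
    show "?\<Phi> t \<le> N * K"
      using t yX sum_bounded_above[of UNIV "\<lambda>i. bregman \<psi> y (z i t)" K] by (simp add: bregman_le z_in N_def)
  qed (use T in auto)
  also have "N * K * 1 \<le> N * K * real T powr (1 - c)"
    using T pos by (intro mult_left_mono ge_one_powr_ge_zero) (auto simp: N_def)
  also have "N * (F + 2 * G1\<^sup>2 / \<sigma>) * (\<Sum>t=1..T. \<alpha> t) \<le> N * (F + 2 * G1\<^sup>2 / \<sigma>) * (real T powr (1 - c) / (1 - c))"
    using T pos by (intro mult_left_mono sum_\<alpha>) (auto simp: N_def)
  also have "N * K * real T powr (1 - c) + \<dots> = M * real T powr (1 - c)"
  proof -
    have "N * K * u + N * h * (u / (1 - c)) = N * (K + h / (1 - c)) * u" for h u
      by (simp add: algebra_simps)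
    then show ?thesis by (simp add: M N_def)
  qed
  finally have main: "\<gamma>0 / 2 * V + \<sigma> / 4 * S \<le> M * real T powr (1 - c)" by simp
  have "V \<ge> 0" "S \<ge> 0" by (auto simp: V_def S_def sum_nonneg)
  then have "\<gamma>0 / 2 * V \<ge> 0" "\<sigma> / 4 * S \<ge> 0" using pos by auto
  then have "\<gamma>0 / 2 * V \<le> M * real T powr (1 - c)" "\<sigma> / 4 * S \<le> M * real T powr (1 - c)" using main by linarith+
  then show "(\<Sum>t=1..T. \<Sum>i\<in>UNIV. (viol i t)\<^sup>2) \<le> 2 * M / \<gamma>0 * real T powr (1 - c)"
    and "(\<Sum>t=1..T. \<Sum>i\<in>UNIV. (move i t)\<^sup>2) \<le> 4 * M / \<sigma> * real T powr (1 - c)"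
    unfolding V_def[symmetric] S_def[symmetric] using pos by (auto simp: field_simps)
qed

text \<open>Agent \<open>j\<close>'s constraints are only penalised at \<open>x j t\<close>;
  Lipschitz continuity transports them from \<open>x i t\<close> to that point, block by
  block.\<close>

lemma stacked_violation_le:
  assumes "t \<ge> 1"
  shows "stacked_violation m g t (x i t) \<le> (\<Sum>j\<in>UNIV. viol j t + G2 * norm (x i t - x j t))"
proof -
  have "stacked_violation m g t (x i t) = L2_set (\<lambda>j. L2_set (\<lambda>k. max 0 (g j t (x i t) k)) {..<m j}) UNIV"
    by (simp add: stacked_violation_def L2_set_def sum_nonneg sum.Sigma case_prod_unfold)
  also have "\<dots> \<le> (\<Sum>j\<in>UNIV. L2_set (\<lambda>k. max 0 (g j t (x i t) k)) {..<m j})"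
    by (rule L2_set_le_sum) (simp add: L2_set_nonneg)
  also have "\<dots> \<le> (\<Sum>j\<in>UNIV. viol j t + G2 * norm (x i t - x j t))"
    unfolding viol_def using assms by (intro sum_mono g_norm_lipschitz x_in) auto
  finally show ?thesis .
qed

lemma net_ccv_bound:
  assumes T: "T \<ge> 1" and ne: "feasible X m g T \<noteq> {}"
    and M: "M = CARD('n) * (K + (F + 2 * G1\<^sup>2 / \<sigma>) / (1 - c))"
  shows "net_ccv m g x T \<le> ((2 * M / \<gamma>0 + CARD('n)) / 2
      + CARD('n) * G2 * \<kappa> * (D + (4 * M / \<sigma> + CARD('n)) / 2)) * real T powr (1 - c / 2)"
    (is "_ \<le> ?b")
proof -
  define N where "N = real CARD('n)"
  define U where "U = real T powr (1 - c / 2)"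
  have U: "U \<ge> 1" unfolding U_def using T pos by (intro ge_one_powr_ge_zero) auto
  have \<kappa>: "\<kappa> \<ge> 0" by (simp add: \<kappa>_eq)
  have D: "D \<ge> 0" using pos by (simp add: D_eq)
  have move_sum: "(\<Sum>t=1..T. \<Sum>i\<in>UNIV. move i t) \<le> (4 * M / \<sigma> + N) / 2 * U"
    unfolding N_def U_def by (rule sum_le_of_sum_squares[OF square_sums(2)[OF T ne M] T])
  have viol_sum: "(\<Sum>t=1..T. \<Sum>i\<in>UNIV. viol i t) \<le> (2 * M / \<gamma>0 + N) / 2 * U"
    unfolding N_def U_def by (rule sum_le_of_sum_squares[OF square_sums(1)[OF T ne M] T])
  have "(\<Sum>t=1..T. stacked_violation m g t (x i t)) \<le> ?b" for i
  proof -
    have "(\<Sum>t=1..T. \<Sum>j\<in>UNIV. norm (x i t - x j t)) = (\<Sum>j\<in>UNIV. \<Sum>t=1..T. norm (x i t - x j t))"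
      by (rule sum.swap)
    also have "\<dots> \<le> (\<Sum>j\<in>(UNIV::'n set). \<kappa> * (D + (\<Sum>t=1..T. \<Sum>i\<in>UNIV. move i t)))"
      by (intro sum_mono consensus)
    also have "\<dots> = N * \<kappa> * (D + (\<Sum>t=1..T. \<Sum>i\<in>UNIV. move i t))"
      by (simp add: N_def)
    \<comment> \<open>\<open>U \<ge> 1\<close> lets the constant \<open>D\<close> join the growing
      term.\<close>
    also have "\<dots> \<le> N * \<kappa> * (D * U + (4 * M / \<sigma> + N) / 2 * U)"
      using move_sum \<kappa> D U mult_left_mono[OF U D] by (intro mult_left_mono add_mono) (auto simp: N_def)
    finally have distances: "G2 * (\<Sum>t=1..T. \<Sum>j\<in>UNIV. norm (x i t - x j t))
        \<le> G2 * (N * \<kappa> * (D * U + (4 * M / \<sigma> + N) / 2 * U))"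
      using pos by (intro mult_left_mono) auto
    have "(\<Sum>t=1..T. stacked_violation m g t (x i t))
        \<le> (\<Sum>t=1..T. \<Sum>j\<in>UNIV. viol j t + G2 * norm (x i t - x j t))"
      by (intro sum_mono stacked_violation_le) auto
    also have "\<dots> = (\<Sum>t=1..T. \<Sum>j\<in>UNIV. viol j t) + G2 * (\<Sum>t=1..T. \<Sum>j\<in>UNIV. norm (x i t - x j t))"
      by (simp add: sum.distrib sum_distrib_left)
    also have "\<dots> \<le> (2 * M / \<gamma>0 + N) / 2 * U + G2 * (N * \<kappa> * (D * U + (4 * M / \<sigma> + N) / 2 * U))"
      by (intro add_mono viol_sum distances)
    also have "\<dots> = ?b" unfolding N_def[symmetric] U_def[symmetric] by (simp add: algebra_simps)
    finally show ?thesis .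
  qed
  then have "(\<Sum>i\<in>(UNIV::'n set). \<Sum>t=1..T. stacked_violation m g t (x i t)) \<le> CARD('n) * ?b"
    by (intro sum_bounded_above)
  then show ?thesis by (simp add: net_ccv_def field_simps)
qed

end

section \<open>Constants uniform over all runs\<close>

theorem theorem1:
  fixes m :: "'n::finite \<Rightarrow> nat"
    and F G1 G2 w \<sigma> K c \<gamma>0 :: real
    and B :: nat
    and z1 :: "'n \<Rightarrow> real^'p"
  assumes "F > 0" and "G1 > 0" and "G2 > 0"
    and "0 < w" and "w < 1" and "B > 0"
    and "\<sigma> > 0" and "K > 0"
    and "0 < c" and "c < 1"
    and "0 < \<gamma>0" and "\<gamma>0 \<le> \<sigma> / (4 * G2\<^sup>2)"
  shows "\<exists>C1>0. \<exists>C2>0.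
    \<forall>(X :: (real^'p) set) (\<psi> :: real^'p \<Rightarrow> real)
     (f :: 'n \<Rightarrow> nat \<Rightarrow> real^'p \<Rightarrow> real) (r :: nat \<Rightarrow> real^'p \<Rightarrow> real)
     (g :: 'n \<Rightarrow> nat \<Rightarrow> real^'p \<Rightarrow> nat \<Rightarrow> real)
     (E :: nat \<Rightarrow> ('n \<times> 'n) set) (W :: nat \<Rightarrow> real^'n^'n)
     (\<alpha> :: nat \<Rightarrow> real) (\<gamma> :: nat \<Rightarrow> real) (x :: 'n \<Rightarrow> nat \<Rightarrow> real^'p).
      (\<forall>T\<ge>1. feasible X m g T \<noteq> {}) \<longrightarrow>
      (\<forall>t\<ge>1. mixing_matrix (E t) (W t)) \<longrightarrow>
      (\<forall>y\<in>X. \<exists>d. GDERIV \<psi> y :> d) \<longrightarrow> strongly_convex_on X \<psi> \<sigma> \<longrightarrow>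
      closed X \<longrightarrow> convex X \<longrightarrow>
      (\<forall>t\<ge>1. convex_on UNIV (r t)) \<longrightarrow>
      (\<forall>i. \<forall>t\<ge>1. convex_on UNIV (f i t)) \<longrightarrow>
      (\<forall>i. \<forall>t\<ge>1. \<forall>k<m i. convex_on UNIV (\<lambda>y. g i t y k)) \<longrightarrow>
      (\<forall>i. \<forall>t\<ge>1. \<forall>y\<in>X. \<forall>y'\<in>X. \<bar>local_loss f r i t y - local_loss f r i t y'\<bar> \<le> F) \<longrightarrow>
      (\<forall>t\<ge>1. \<forall>y\<in>X. \<exists>s. subgradient (r t) y s) \<longrightarrow>
      (\<forall>i. \<forall>t\<ge>1. \<forall>y\<in>X. \<exists>s. subgradient (f i t) y s) \<longrightarrow>
      (\<forall>i. \<forall>t\<ge>1. \<forall>y\<in>X. \<exists>A. subgradient_matrix (m i) (g i t) y A) \<longrightarrow>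
      (\<forall>i. \<forall>t\<ge>1. \<forall>y\<in>X. \<forall>s s'. subgradient (f i t) y s \<longrightarrow> subgradient (r t) y s' \<longrightarrow>
          norm (s + s') \<le> G1) \<longrightarrow>
      (\<forall>i. \<forall>t\<ge>1. \<forall>y\<in>X. \<forall>A. subgradient_matrix (m i) (g i t) y A \<longrightarrow>
          matrix_norm2 (m i) A \<le> G2) \<longrightarrow>
      (\<forall>t\<ge>1. \<forall>i j. W t $ i $ j > 0 \<longrightarrow> W t $ i $ j \<ge> w) \<longrightarrow>
      (\<forall>t\<ge>1. doubly_stochastic (W t)) \<longrightarrow>
      (\<forall>t\<ge>1. strongly_connected_digraph (\<Union>l<B. E (t + l))) \<longrightarrow>
      (\<forall>y\<in>X. convex_on X (\<lambda>y'. bregman \<psi> y y')) \<longrightarrow>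
      (\<forall>y\<in>X. \<forall>y'\<in>X. bregman \<psi> y y' \<le> K) \<longrightarrow>
      (\<forall>t\<ge>1. \<alpha> t = 1 / real t powr c) \<longrightarrow>
      (\<forall>t\<ge>1. \<gamma> t = \<gamma>0 / \<alpha> t) \<longrightarrow>
      primal_dual_mirror_descent X \<psi> m f r g W \<alpha> \<gamma> z1 x \<longrightarrow>
      (\<forall>T\<ge>1. net_regret X m f r g x T \<le> C1 * real T powr (max c (1 - c)) \<and>
              net_ccv m g x T \<le> C2 * real T powr (1 - c / 2))"
proof -
  \<comment> \<open>All constants are built from the fixed parameters alone, before the functions,
    graphs and iterates are introduced.\<close>
  define \<kappa> where "\<kappa> = 2 * real (CARD('n) * B) / (w ^ (CARD('n) * B))\<^sup>2"
  define D where "D = sqrt (2 * K / \<sigma>)"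
  define M where "M = CARD('n) * (K + (F + 2 * G1\<^sup>2 / \<sigma>) / (1 - c))"
  define C1 where "C1 = K + (2 * G1\<^sup>2 / \<sigma> + (G1 * CARD('n) * \<kappa>)\<^sup>2 / \<sigma>) / (1 - c) + G1 * \<kappa> * D"
  define C2 where "C2 = (2 * M / \<gamma>0 + CARD('n)) / 2
    + CARD('n) * G2 * \<kappa> * (D + (4 * M / \<sigma> + CARD('n)) / 2)"
  have nonneg: "\<kappa> \<ge> 0" "D \<ge> 0" "M \<ge> 0"
    using assms by (auto simp: \<kappa>_def D_def M_def)
  have C1: "C1 > 0" unfolding C1_def
    using assms nonneg by (intro add_pos_nonneg divide_nonneg_nonneg add_nonneg_nonneg mult_nonneg_nonneg) auto
  have C2: "C2 > 0" unfolding C2_def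
    using assms nonneg
    by (intro add_pos_nonneg half_gt_zero add_nonneg_pos mult_nonneg_nonneg add_nonneg_nonneg divide_nonneg_nonneg) auto
  show ?thesis
  proof (rule exI[of _ C1], rule conjI[OF C1], rule exI[of _ C2], rule conjI[OF C2], intro allI impI)
    fix X :: "(real^'p) set" and \<psi> :: "real^'p \<Rightarrow> real"
      and f :: "'n \<Rightarrow> nat \<Rightarrow> real^'p \<Rightarrow> real" and r :: "nat \<Rightarrow> real^'p \<Rightarrow> real"
      and g :: "'n \<Rightarrow> nat \<Rightarrow> real^'p \<Rightarrow> nat \<Rightarrow> real"
      and E :: "nat \<Rightarrow> ('n \<times> 'n) set" and W :: "nat \<Rightarrow> real^'n^'n"
      and \<alpha> \<gamma> :: "nat \<Rightarrow> real" and x :: "'n \<Rightarrow> nat \<Rightarrow> real^'p" and T :: nat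
    assume ne: "\<forall>T\<ge>1. feasible X m g T \<noteq> {}" and T: "1 \<le> T"
      and H1: "\<forall>t\<ge>1. mixing_matrix (E t) (W t)"
        "\<forall>t\<ge>1. \<forall>i j. W t $ i $ j > 0 \<longrightarrow> W t $ i $ j \<ge> w"
        "\<forall>t\<ge>1. doubly_stochastic (W t)"
        "\<forall>t\<ge>1. strongly_connected_digraph (\<Union>l<B. E (t + l))"
      and H2: "\<forall>y\<in>X. \<exists>d. GDERIV \<psi> y :> d" "strongly_convex_on X \<psi> \<sigma>"
        "convex X" "\<forall>t\<ge>1. convex_on UNIV (r t)"
        "\<forall>i. \<forall>t\<ge>1. \<forall>y\<in>X. \<forall>y'\<in>X. \<bar>local_loss f r i t y - local_loss f r i t y'\<bar> \<le> F"
        "\<forall>t\<ge>1. \<forall>y\<in>X. \<exists>s. subgradient (r t) y s"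
        "\<forall>i. \<forall>t\<ge>1. \<forall>y\<in>X. \<exists>s. subgradient (f i t) y s"
        "\<forall>i. \<forall>t\<ge>1. \<forall>y\<in>X. \<exists>A. subgradient_matrix (m i) (g i t) y A"
        "\<forall>i. \<forall>t\<ge>1. \<forall>y\<in>X. \<forall>s s'. subgradient (f i t) y s \<longrightarrow> subgradient (r t) y s' \<longrightarrow>
          norm (s + s') \<le> G1"
        "\<forall>i. \<forall>t\<ge>1. \<forall>y\<in>X. \<forall>A. subgradient_matrix (m i) (g i t) y A \<longrightarrow>
          matrix_norm2 (m i) A \<le> G2"
        "\<forall>y\<in>X. convex_on X (\<lambda>y'. bregman \<psi> y y')"
        "\<forall>y\<in>X. \<forall>y'\<in>X. bregman \<psi> y y' \<le> K"
        "\<forall>t\<ge>1. \<alpha> t = 1 / real t powr c"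
        "\<forall>t\<ge>1. \<gamma> t = \<gamma>0 / \<alpha> t"
      and run: "primal_dual_mirror_descent X \<psi> m f r g W \<alpha> \<gamma> z1 x"
    obtain z :: "'n \<Rightarrow> nat \<Rightarrow> real^'p" and q :: "'n \<Rightarrow> nat \<Rightarrow> nat \<Rightarrow> real"
      and \<omega> df :: "'n \<Rightarrow> nat \<Rightarrow> real^'p" and dg :: "'n \<Rightarrow> nat \<Rightarrow> nat \<Rightarrow> real^'p"
      where init: "\<And>i. z1 i \<in> X \<and> z i 1 = z1 i"
        and step: "\<And>t i. t \<ge> 1 \<Longrightarrow> x i t = (\<Sum>j\<in>UNIV. W t $ i $ j *\<^sub>R z j t) \<and>
           subgradient (f i t) (x i t) (df i t) \<and>
           subgradient_matrix (m i) (g i t) (x i t) (dg i t) \<and>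
           (\<forall>k<m i. q i (t + 1) k = \<gamma> t * max 0 (g i t (x i t) k)) \<and>
           \<omega> i (t + 1) = df i t + (\<Sum>k<m i. q i (t + 1) k *\<^sub>R dg i t k) \<and>
           is_arg_min (\<lambda>y. \<alpha> t * (y \<bullet> \<omega> i (t + 1)) + \<alpha> t * r t y + bregman \<psi> y (x i t))
             (\<lambda>y. y \<in> X) (z i (t + 1))"
      using run unfolding primal_dual_mirror_descent_def by (elim exE conjE) blast
    \<comment> \<open>The multiplier \<open>q\<close> is determined only at indices below
      \<open>m i\<close>, exactly those over which the sum runs.\<close>
    have \<omega>: "\<omega> i (t + 1) = df i t + (\<Sum>k<m i. (\<gamma> t * max 0 (g i t (x i t) k)) *\<^sub>R dg i t k)"
      if "t \<ge> 1" for t i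
      using step[OF that, of i] by auto
    have argmin: "is_arg_min
      (\<lambda>y. \<alpha> t * (y \<bullet> (df i t + (\<Sum>k<m i. (\<gamma> t * max 0 (g i t (x i t) k)) *\<^sub>R dg i t k)))
        + \<alpha> t * r t y + bregman \<psi> y (x i t)) (\<lambda>y. y \<in> X) (z i (Suc t))"
      if "t \<ge> 1" for t i
      using step[OF that, of i] unfolding \<omega>[OF that] Suc_eq_plus1 by blast
    interpret mirror_descent_run W E w B X \<psi> m f r g \<alpha> \<gamma> x z df dg F G1 G2 \<sigma> K c \<gamma>0 \<kappa> D
    proof
      show "z i 1 \<in> X" for i using init by metis
      show "x i t = (\<Sum>j\<in>UNIV. W t $ i $ j *\<^sub>R z j t)" if "t \<ge> 1" for i t
        using step[OF that, of i] by blast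
      show "subgradient (f i t) (x i t) (df i t)" if "t \<ge> 1" for i t
        using step[OF that, of i] by blast
      show "subgradient_matrix (m i) (g i t) (x i t) (dg i t)" if "t \<ge> 1" for i t
        using step[OF that, of i] by blast
    qed (use assms H1 H2 argmin in \<open>simp_all add: \<kappa>_def D_def\<close>)
    show "net_regret X m f r g x T \<le> C1 * real T powr (max c (1 - c)) \<and>
        net_ccv m g x T \<le> C2 * real T powr (1 - c / 2)"
      unfolding C1_def C2_def using ne T by (intro conjI net_regret_bound net_ccv_bound M_def) auto
  qed
qed

end
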